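(* Let $(\mu_z^\varepsilon)$ be a time-analytic local random walk on $\mathcal G$. For every fixed pair of distinct vertices $x,y$, the function $\varepsilon\mapsto{}^{\mathcal O}\mathrm{Ric}_\varepsilon(x,y)$ is locally Lipschitz on $(0,1)$ and is piecewise analytic, with finitely many distinct analytic pieces on $[0,1]$. The same holds with "time-analytic" replaced by "time-affine" (resp. "time-polynomial") and "piecewise analytic" replaced by "piecewise affine" (resp. "piecewise polynomial").
   Context: $\mathcal G$ is a locally finite graph with vertex set $V$, and $\mathrm d$ is a distance on $V$ with $(V,\mathrm d)$ complete. A random walk is a family of probability measures $\mu_z^\varepsilon$ on $V$ ($z\in V$, $\varepsilon\in[0,1]$) with finite first moments, continuous in $\varepsilon$, $\mu_z^0=\delta_z$. It is local if for each $z$ there is a finite set $\mathcal K_z\subset V$ with $\mathrm{supp}(\mu_z^\varepsilon)\subset\mathcal K_z$ for all $\varepsilon$. It is time-analytic (resp. time-affine, time-polynomial) if for all $x,y$ the function $p_{xy}(\varepsilon):=\mu_x^\varepsilon(y)$ is analytic (resp. affine, polynomial) in $\varepsilon$ and admits an analytic continuation to $(-\delta_{xy},1+\delta_{xy})$ for some $\delta_{xy}>0$ (the continuation need not be a probability measure). $\mathcal W_1$ is the $L^1$-Wasserstein distance with respect to $\mathrm d$, and ${}^{\mathcal O}\mathrm{Ric}_\varepsilon(x,y):=1-\mathcal W_1(\mu_x^\varepsilon,\mu_y^\varepsilon)/\mathrm d(x,y)$. *)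

theory Defs
  imports "HOL-Analysis.Analysis" "HOL-Probability.Probability"
    "HOL-Computational_Algebra.Polynomial"
begin

definition locally_finite_graph :: "('v \<Rightarrow> 'v \<Rightarrow> bool) \<Rightarrow> bool" where
  "locally_finite_graph E \<longleftrightarrow> (\<forall>x y. E x y \<longleftrightarrow> E y x) \<and> (\<forall>x. finite {y. E x y})"

definition complete_distance :: "('v \<Rightarrow> 'v \<Rightarrow> real) \<Rightarrow> bool" where
  "complete_distance d \<longleftrightarrow> Metric_space UNIV d \<and> Metric_space.mcomplete UNIV d"

definition W1 :: "('v \<Rightarrow> 'v \<Rightarrow> real) \<Rightarrow> 'v pmf \<Rightarrow> 'v pmf \<Rightarrow> real" where
  "W1 d \<mu> \<nu> = Inf {measure_pmf.expectation \<pi> (\<lambda>(a,b). d a b) | \<pi>.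
      map_pmf fst \<pi> = \<mu> \<and> map_pmf snd \<pi> = \<nu>}"

definition random_walk :: "('v \<Rightarrow> 'v \<Rightarrow> real) \<Rightarrow> ('v \<Rightarrow> real \<Rightarrow> 'v pmf) \<Rightarrow> bool" where
  "random_walk d mu \<longleftrightarrow>
     (\<forall>z. \<forall>\<epsilon>\<in>{0..1}. \<forall>w. integrable (measure_pmf (mu z \<epsilon>)) (\<lambda>a. d w a)) \<and>
     (\<forall>z. \<forall>\<epsilon>\<in>{0..1}. ((\<lambda>t. W1 d (mu z t) (mu z \<epsilon>)) \<longlongrightarrow> 0) (at \<epsilon> within {0..1})) \<and>
     (\<forall>z. mu z 0 = return_pmf z)"

definition local_walk :: "('v \<Rightarrow> real \<Rightarrow> 'v pmf) \<Rightarrow> bool" where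
  "local_walk mu \<longleftrightarrow> (\<forall>z. \<exists>K. finite K \<and> (\<forall>\<epsilon>\<in>{0..1}. set_pmf (mu z \<epsilon>) \<subseteq> K))"

definition real_analytic_on :: "(real \<Rightarrow> real) \<Rightarrow> real set \<Rightarrow> bool" where
  "real_analytic_on f S \<longleftrightarrow> (\<forall>t\<in>S. \<exists>r>0. \<exists>a::nat \<Rightarrow> real.
      \<forall>s. \<bar>s - t\<bar> < r \<longrightarrow> (\<lambda>n. a n * (s - t) ^ n) sums f s)"

definition time_analytic :: "('v \<Rightarrow> real \<Rightarrow> 'v pmf) \<Rightarrow> bool" where
  "time_analytic mu \<longleftrightarrow> (\<forall>x y. \<exists>\<delta>>0. \<exists>g. real_analytic_on g {-\<delta><..<1+\<delta>} \<and>
      (\<forall>\<epsilon>\<in>{0..1}. g \<epsilon> = pmf (mu x \<epsilon>) y))"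

definition time_affine :: "('v \<Rightarrow> real \<Rightarrow> 'v pmf) \<Rightarrow> bool" where
  "time_affine mu \<longleftrightarrow> (\<forall>x y. \<exists>\<alpha> \<beta>. \<forall>\<epsilon>\<in>{0..1}. pmf (mu x \<epsilon>) y = \<alpha> + \<beta> * \<epsilon>)"

definition time_polynomial :: "('v \<Rightarrow> real \<Rightarrow> 'v pmf) \<Rightarrow> bool" where
  "time_polynomial mu \<longleftrightarrow> (\<forall>x y. \<exists>q :: real poly. \<forall>\<epsilon>\<in>{0..1}. pmf (mu x \<epsilon>) y = poly q \<epsilon>)"

definition ORic :: "('v \<Rightarrow> 'v \<Rightarrow> real) \<Rightarrow> ('v \<Rightarrow> real \<Rightarrow> 'v pmf) \<Rightarrow> real \<Rightarrow> 'v \<Rightarrow> 'v \<Rightarrow> real" where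
  "ORic d mu \<epsilon> x y = 1 - W1 d (mu x \<epsilon>) (mu y \<epsilon>) / d x y"

definition locally_lipschitz_on :: "real set \<Rightarrow> (real \<Rightarrow> real) \<Rightarrow> bool" where
  "locally_lipschitz_on S f \<longleftrightarrow> (\<forall>t\<in>S. \<exists>r>0. \<exists>L. \<forall>s\<in>S \<inter> ball t r. \<forall>u\<in>S \<inter> ball t r.
      \<bar>f s - f u\<bar> \<le> L * \<bar>s - u\<bar>)"

definition piecewise_on_unit :: "((real \<Rightarrow> real) \<Rightarrow> real \<Rightarrow> real \<Rightarrow> bool) \<Rightarrow> (real \<Rightarrow> real) \<Rightarrow> bool" where
  "piecewise_on_unit P f \<longleftrightarrow> (\<exists>n::nat. \<exists>t::nat \<Rightarrow> real. n \<ge> 1 \<and> t 0 = 0 \<and> t n = 1 \<and>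
      (\<forall>i<n. t i < t (Suc i)) \<and>
      (\<forall>i<n. \<exists>g. P g (t i) (t (Suc i)) \<and> (\<forall>s\<in>{t i..t (Suc i)}. f s = g s)))"

definition analytic_piece :: "(real \<Rightarrow> real) \<Rightarrow> real \<Rightarrow> real \<Rightarrow> bool" where
  "analytic_piece g a b \<longleftrightarrow> (\<exists>U. open U \<and> {a..b} \<subseteq> U \<and> real_analytic_on g U)"

definition affine_piece :: "(real \<Rightarrow> real) \<Rightarrow> real \<Rightarrow> real \<Rightarrow> bool" where
  "affine_piece g a b \<longleftrightarrow> (\<exists>\<alpha> \<beta>. \<forall>s. g s = \<alpha> + \<beta> * s)"

definition polynomial_piece :: "(real \<Rightarrow> real) \<Rightarrow> real \<Rightarrow> real \<Rightarrow> bool" where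
  "polynomial_piece g a b \<longleftrightarrow> (\<exists>q :: real poly. \<forall>s. g s = poly q s)"

end

theory Submission
  imports Defs "HOL-Complex_Analysis.Cauchy_Integral_Formula"
begin

text \<open>
  On a finite set \<open>K\<close>, every transport plan can be moved along circulations, without raising the cost,
  to a plan whose support carries no circulation. On such a support the cost function splits
  as \<open>u a + v b\<close>, so the cost of the plan is a linear functional of the two marginals that depends on
  the support only. Hence \<open>W1\<close> is at every time one of finitely many fixed linear combinations of the
  transition probabilities. It is also continuous in time, by the triangle inequality for \<open>W1\<close>.
  A continuous selection from finitely many functions, any two of which agree everywhere or only
  finitely often, follows a single one of them between consecutive coincidence points, and
  it inherits their common Lipschitz constant.
\<close>

text \<open>The potentials \<open>u\<close>, \<open>v\<close> only have to match the cost on the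
  support of one plan. They need not satisfy \<open>u a + v b \<le> c a b\<close> elsewhere, so no
  Kantorovich duality enters, and finiteness comes from the finite number of subsets of
  \<open>K \<times> K\<close>. The price is that \<open>W1\<close> is known only as a selection from
  the functionals, not as their maximum or minimum. A mere selection could jump, so continuity has
  to come from elsewhere. The walk is continuous in the sense of \<open>W1\<close> itself, one
  vertex at a time, and the triangle inequality turns this into continuity of the distance between
  two moving measures. In the analytic case the continuation beyond 0 and 1 is essential: it
  prevents the coincidence points of two functionals from accumulating at an endpoint, so that
  finitely many pieces cover the closed interval.\<close>

section \<open>Transport plans on a finite set\<close>

text \<open>An injective linear map between finite-dimensional spaces has a surjective transpose: if
  the columns \<open>m _ s\<close> are independent, functionals on \<open>J\<close> take arbitrary
  values on them. When a column \<open>s0\<close> is added, it is enough to find a functional that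
  kills the columns in \<open>S\<close> but not \<open>s0\<close>.\<close>

lemma independent_columns_interpolate:
  fixes m :: "'j \<Rightarrow> 's \<Rightarrow> real"
  assumes J: "finite J" and "finite S"
    and "\<And>w. (\<And>j. j \<in> J \<Longrightarrow> (\<Sum>s\<in>S. w s * m j s) = 0) \<Longrightarrow> (\<forall>s\<in>S. w s = 0)"
  shows "\<exists>u. \<forall>s\<in>S. (\<Sum>j\<in>J. u j * m j s) = c s"
  using assms(2,3)
proof (induction S arbitrary: c rule: finite_induct)
  case empty
  then show ?case by simp
next
  case (insert s0 S)
  have IH: "\<exists>u. \<forall>s\<in>S. (\<Sum>j\<in>J. u j * m j s) = c s" for c
  proof (rule insert.IH)
    fix w assume w: "\<And>j. j \<in> J \<Longrightarrow> (\<Sum>s\<in>S. w s * m j s) = 0"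
    have "\<forall>s\<in>insert s0 S. (w(s0 := 0)) s = 0"
    proof (rule insert.prems)
      fix j assume "j \<in> J"
      have "(\<Sum>s\<in>S. (w(s0 := 0)) s * m j s) = (\<Sum>s\<in>S. w s * m j s)"
        using insert.hyps by (intro sum.cong) auto
      then show "(\<Sum>s\<in>insert s0 S. (w(s0 := 0)) s * m j s) = 0"
        using insert.hyps w[OF \<open>j \<in> J\<close>] by simp
    qed
    then show "\<forall>s\<in>S. w s = 0"
      using insert.hyps by (metis fun_upd_other insertCI)
  qed
  have "\<exists>u. (\<forall>s\<in>S. (\<Sum>j\<in>J. u j * m j s) = 0) \<and> (\<Sum>j\<in>J. u j * m j s0) \<noteq> 0"
  proof (rule ccontr)
    assume neg: "\<not> ?thesis"
    \<comment> \<open>The induction hypothesis provides a family \<open>U r\<close> dual to the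
      columns in \<open>S\<close>. If every functional killing these columns also kills column
      \<open>s0\<close>, then column \<open>s0\<close> is their combination with coefficients
      \<open>a r\<close>, and \<open>w\<close> is the forbidden linear relation.\<close>
    have "\<forall>r. \<exists>u. \<forall>s\<in>S. (\<Sum>j\<in>J. u j * m j s) = of_bool (s = r)"
      by (intro allI IH)
    then obtain U where U: "\<And>r s. s \<in> S \<Longrightarrow> (\<Sum>j\<in>J. U r j * m j s) = of_bool (s = r)"
      by metis
    define a where "a r = (\<Sum>j\<in>J. U r j * m j s0)" for r
    define w where "w s = (if s = s0 then -1 else a s)" for s
    have "\<forall>s\<in>insert s0 S. w s = 0"
    proof (rule insert.prems)
      fix i assume i: "i \<in> J"
      \<comment> \<open>the \<open>i\<close>-th coordinate functional, corrected so as to vanish on the columns in \<open>S\<close>\<close>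
      define v where "v j = of_bool (j = i) - (\<Sum>r\<in>S. m i r * U r j)" for j
      have v: "(\<Sum>j\<in>J. v j * m j s) = m i s - (\<Sum>r\<in>S. m i r * (\<Sum>j\<in>J. U r j * m j s))" for s
      proof -
        have "(\<Sum>j\<in>J. v j * m j s)
            = (\<Sum>j\<in>J. of_bool (j = i) * m j s) - (\<Sum>j\<in>J. \<Sum>r\<in>S. m i r * (U r j * m j s))"
          by (simp add: v_def left_diff_distrib sum_subtractf sum_distrib_right mult.assoc)
        also have "(\<Sum>j\<in>J. of_bool (j = i) * m j s) = m i s"
          using i J by (simp add: of_bool_def if_distrib[of "\<lambda>x. x * _"] sum.delta cong: if_cong)
        also have "(\<Sum>j\<in>J. \<Sum>r\<in>S. m i r * (U r j * m j s))
            = (\<Sum>r\<in>S. m i r * (\<Sum>j\<in>J. U r j * m j s))"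
          by (subst sum.swap) (simp add: sum_distrib_left)
        finally show ?thesis .
      qed
      have "(\<Sum>j\<in>J. v j * m j s) = 0" if "s \<in> S" for s
        unfolding v using that insert.hyps(1)
        by (simp add: U of_bool_def if_distrib[of "\<lambda>x. _ * x"] sum.delta cong: if_cong)
      then have "(\<Sum>j\<in>J. v j * m j s0) = 0"
        using neg by blast
      then have "m i s0 = (\<Sum>r\<in>S. m i r * a r)"
        by (simp add: v a_def)
      moreover have "(\<Sum>r\<in>S. w r * m i r) = (\<Sum>r\<in>S. m i r * a r)"
        using insert.hyps by (intro sum.cong) (auto simp: w_def)
      ultimately show "(\<Sum>s\<in>insert s0 S. w s * m i s) = 0"
        using insert.hyps by (simp add: w_def)
    qed
    then show False
      by (simp add: w_def)
  qed
  then obtain u0 where u0: "\<forall>s\<in>S. (\<Sum>j\<in>J. u0 j * m j s) = 0" "(\<Sum>j\<in>J. u0 j * m j s0) \<noteq> 0"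
    by blast
  obtain u1 where u1: "\<forall>s\<in>S. (\<Sum>j\<in>J. u1 j * m j s) = c s"
    using IH by blast
  define k where "k = (c s0 - (\<Sum>j\<in>J. u1 j * m j s0)) / (\<Sum>j\<in>J. u0 j * m j s0)"
  have "(\<Sum>j\<in>J. (u1 j + k * u0 j) * m j s)
      = (\<Sum>j\<in>J. u1 j * m j s) + k * (\<Sum>j\<in>J. u0 j * m j s)" for s
    by (simp add: distrib_right sum.distrib sum_distrib_left mult.assoc)
  then have "\<forall>s\<in>insert s0 S. (\<Sum>j\<in>J. (u1 j + k * u0 j) * m j s) = c s"
    using u0 u1 by (auto simp: k_def)
  then show ?case by (rule exI[of _ "\<lambda>j. u1 j + k * u0 j"])
qed

text \<open>Forcing the value 0 off \<open>K \<times> K\<close> makes the support a finite set when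
  \<open>K\<close> is finite, as the induction on its cardinality requires, and lets a plan between
  probability vectors be read directly as a mass function on all pairs.\<close>

definition transport_plan :: "'v set \<Rightarrow> ('v \<Rightarrow> real) \<Rightarrow> ('v \<Rightarrow> real) \<Rightarrow> ('v \<times> 'v \<Rightarrow> real) \<Rightarrow> bool" where
  "transport_plan K p q \<pi> \<longleftrightarrow> (\<forall>s. 0 \<le> \<pi> s) \<and> (\<forall>s. s \<notin> K \<times> K \<longrightarrow> \<pi> s = 0) \<and>
     (\<forall>a\<in>K. (\<Sum>b\<in>K. \<pi> (a, b)) = p a) \<and> (\<forall>b\<in>K. (\<Sum>a\<in>K. \<pi> (a, b)) = q b)"

lemma transport_plan_nonneg: "transport_plan K p q \<pi> \<Longrightarrow> 0 \<le> \<pi> s"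
  unfolding transport_plan_def by blast

lemma transport_plan_outside: "transport_plan K p q \<pi> \<Longrightarrow> s \<notin> K \<times> K \<Longrightarrow> \<pi> s = 0"
  unfolding transport_plan_def by blast

definition transport_cost :: "'v set \<Rightarrow> ('v \<Rightarrow> 'v \<Rightarrow> real) \<Rightarrow> ('v \<times> 'v \<Rightarrow> real) \<Rightarrow> real" where
  "transport_cost K c \<pi> = (\<Sum>a\<in>K. \<Sum>b\<in>K. c a b * \<pi> (a, b))"

text \<open>These are the signed perturbations that leave both marginals on \<open>K\<close>
  unchanged.\<close>

definition circulation :: "'v set \<Rightarrow> ('v \<times> 'v \<Rightarrow> real) \<Rightarrow> bool" where
  "circulation K w \<longleftrightarrow> (\<forall>a\<in>K. (\<Sum>b\<in>K. w (a, b)) = 0) \<and> (\<forall>b\<in>K. (\<Sum>a\<in>K. w (a, b)) = 0)"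

text \<open>For finite \<open>K\<close> and \<open>S \<subseteq> K \<times> K\<close> this says that
  the bipartite graph with edge set \<open>S\<close> is a forest. Plans with such a support are the
  vertices of the transportation polytope. The linear form of the condition is the one that yields
  independent columns later.\<close>

definition circulation_free :: "'v set \<Rightarrow> ('v \<times> 'v) set \<Rightarrow> bool" where
  "circulation_free K S \<longleftrightarrow>
     (\<forall>w. circulation K w \<longrightarrow> (\<forall>s. s \<notin> S \<longrightarrow> w s = 0) \<longrightarrow> (\<forall>s. w s = 0))"

lemma transport_cost_add_scaled:
  "transport_cost K c (\<lambda>s. \<pi> s + t * w s) = transport_cost K c \<pi> + t * transport_cost K c w"
  by (simp add: transport_cost_def distrib_left sum.distrib sum_distrib_left mult.left_commute)

lemma circulation_uminus: "circulation K w \<Longrightarrow> circulation K (\<lambda>s. - w s)"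
  by (simp add: circulation_def sum_negf)

text \<open>A zero row sum without negative terms forces the whole row to vanish. This is what stops
  a move along a circulation after a finite distance.\<close>

lemma circulation_has_negative_entry:
  assumes K: "finite K" and w: "circulation K w" and ne: "w s \<noteq> 0" and s: "s \<in> K \<times> K"
  shows "\<exists>s\<in>K \<times> K. w s < 0"
proof (rule ccontr)
  assume "\<not> ?thesis"
  then have nn: "w s \<ge> 0" if "s \<in> K \<times> K" for s
    using that by force
  obtain a b where ab: "s = (a, b)" "a \<in> K" "b \<in> K"
    using s by auto
  have "(\<Sum>b\<in>K. w (a, b)) = 0"
    using w ab by (simp add: circulation_def)
  then have "w (a, b) = 0"
    using K nn ab by (subst (asm) sum_nonneg_eq_0_iff) auto
  then show False
    using ne ab by simp
qed

text \<open>Moving a plan along a circulation supported on its support, in the direction that does not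
  raise the cost, until the first entry vanishes removes one point of the support.\<close>

lemma transport_plan_reduce_support:
  assumes K: "finite K"
  shows "transport_plan K p q \<pi> \<Longrightarrow>
    \<exists>\<rho>. transport_plan K p q \<rho> \<and> transport_cost K c \<rho> \<le> transport_cost K c \<pi> \<and>
        circulation_free K {s. \<rho> s \<noteq> 0}"
proof (induction "card {s. \<pi> s \<noteq> 0}" arbitrary: \<pi> rule: less_induct)
  case less
  define S where "S = {s. \<pi> s \<noteq> 0}"
  have SK: "S \<subseteq> K \<times> K"
    using less.prems by (auto simp: S_def transport_plan_def)
  then have fS: "finite S"
    using K finite_subset by blast
  show ?case
  proof (cases "circulation_free K S")
    case True
    then show ?thesis
      using less.prems by (auto simp: S_def)
  next
    case False
    then obtain w0 s0 where w0: "circulation K w0" "\<And>s. s \<notin> S \<Longrightarrow> w0 s = 0" "w0 s0 \<noteq> 0"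
      unfolding circulation_free_def by blast
    have "\<exists>w. circulation K w \<and> (\<forall>s. s \<notin> S \<longrightarrow> w s = 0) \<and> w s0 \<noteq> 0 \<and> transport_cost K c w \<le> 0"
    proof (cases "transport_cost K c w0 \<le> 0")
      case True
      then show ?thesis
        using w0 by blast
    next
      case False
      have "transport_cost K c (\<lambda>s. - w0 s) = - transport_cost K c w0"
        by (simp add: transport_cost_def sum_negf)
      then show ?thesis
        using False w0 circulation_uminus[OF w0(1)] by (intro exI[of _ "\<lambda>s. - w0 s"]) auto
    qed
    then obtain w where w: "circulation K w" "\<And>s. s \<notin> S \<Longrightarrow> w s = 0" "w s0 \<noteq> 0"
      "transport_cost K c w \<le> 0"
      by blast
    define N where "N = {s \<in> S. w s < 0}"
    have "s0 \<in> K \<times> K"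
      using w SK by blast
    then have "N \<noteq> {}"
      using circulation_has_negative_entry[OF K w(1,3)] w(2) by (force simp: N_def)
    have fN: "finite N"
      using fS by (simp add: N_def)
    \<comment> \<open>The ratio test of the simplex method: only entries with \<open>w s < 0\<close>
      limit the step, and an entry \<open>s1\<close> attaining the minimum becomes zero.\<close>
    define t where "t = Min ((\<lambda>s. \<pi> s / - w s) ` N)"
    have pos: "\<pi> s > 0" if "s \<in> S" for s
      using that transport_plan_nonneg[OF less.prems, of s] by (simp add: S_def)
    have "t \<in> (\<lambda>s. \<pi> s / - w s) ` N"
      unfolding t_def using fN \<open>N \<noteq> {}\<close> by (intro Min_in) auto
    then obtain s1 where s1: "s1 \<in> N" "t = \<pi> s1 / - w s1"
      by blast
    have t0: "t \<ge> 0"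
      using s1 pos[of s1] by (auto simp: N_def divide_nonneg_neg)
    define \<sigma> where "\<sigma> s = \<pi> s + t * w s" for s
    have \<sigma>_nonneg: "\<sigma> s \<ge> 0" for s
    proof (cases "s \<in> N")
      case True
      then have "t \<le> \<pi> s / - w s"
        unfolding t_def using fN by (intro Min_le) auto
      moreover have "w s < 0"
        using True by (simp add: N_def)
      ultimately show ?thesis
        by (simp add: \<sigma>_def field_simps)
    next
      case False
      then have "w s \<ge> 0"
        using w(2)[of s] by (cases "s \<in> S") (auto simp: N_def)
      then show ?thesis
        using t0 transport_plan_nonneg[OF less.prems] by (simp add: \<sigma>_def)
    qed
    have plan: "transport_plan K p q \<sigma>"
      unfolding transport_plan_def
    proof (intro conjI ballI allI impI)
      show "\<sigma> s = 0" if "s \<notin> K \<times> K" for s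
        using that SK w(2)[of s] transport_plan_outside[OF less.prems that] by (auto simp: \<sigma>_def)
      show "(\<Sum>b\<in>K. \<sigma> (a, b)) = p a" if "a \<in> K" for a
        using that less.prems w(1)
        by (simp add: \<sigma>_def transport_plan_def circulation_def sum.distrib flip: sum_distrib_left)
      show "(\<Sum>a\<in>K. \<sigma> (a, b)) = q b" if "b \<in> K" for b
        using that less.prems w(1)
        by (simp add: \<sigma>_def transport_plan_def circulation_def sum.distrib flip: sum_distrib_left)
    qed (rule \<sigma>_nonneg)
    have "{s. \<sigma> s \<noteq> 0} \<subseteq> S - {s1}"
    proof
      fix s assume s: "s \<in> {s. \<sigma> s \<noteq> 0}"
      have "\<sigma> s1 = 0"
        using s1 by (auto simp: \<sigma>_def N_def)
      moreover have "\<sigma> s = 0" if "s \<notin> S"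
        using that w(2)[OF that] by (simp add: \<sigma>_def S_def)
      ultimately show "s \<in> S - {s1}"
        using s by auto
    qed
    then have "card {s. \<sigma> s \<noteq> 0} < card S"
      using fS s1 by (intro psubset_card_mono) (auto simp: N_def)
    then obtain \<rho> where \<rho>: "transport_plan K p q \<rho>" "transport_cost K c \<rho> \<le> transport_cost K c \<sigma>"
        "circulation_free K {s. \<rho> s \<noteq> 0}"
      using less.hyps[of \<sigma>] plan unfolding S_def by blast
    have "transport_cost K c \<sigma> \<le> transport_cost K c \<pi>"
      using t0 w(4) unfolding \<sigma>_def transport_cost_add_scaled
      by (simp add: mult_nonneg_nonpos)
    then show ?thesis
      using \<rho> by (meson order_trans)
  qed
qed

text \<open>The potentials solve a linear system whose matrix is the vertex-edge incidence matrix of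
  the bipartite graph on two copies of \<open>K\<close>. A relation between its columns, extended by
  zero off \<open>S\<close>, is exactly a circulation, so freeness gives the independence needed for
  interpolation.\<close>

lemma circulation_free_potentials:
  fixes c :: "'v \<Rightarrow> 'v \<Rightarrow> real"
  assumes K: "finite K" and S: "S \<subseteq> K \<times> K" and free: "circulation_free K S"
  shows "\<exists>u v. \<forall>(a, b)\<in>S. u a + v b = c a b"
proof -
  define m :: "'v + 'v \<Rightarrow> 'v \<times> 'v \<Rightarrow> real" where
    "m j s = (case j of Inl a \<Rightarrow> of_bool (fst s = a) | Inr b \<Rightarrow> of_bool (snd s = b))" for j s
  have fS: "finite S"
    using K S finite_subset by blast
  have "\<exists>u. \<forall>s\<in>S. (\<Sum>j\<in>K <+> K. u j * m j s) = case_prod c s"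
  proof (rule independent_columns_interpolate)
    fix w assume w: "\<And>j. j \<in> K <+> K \<Longrightarrow> (\<Sum>s\<in>S. w s * m j s) = 0"
    define w' where "w' s = (if s \<in> S then w s else 0)" for s
    have sum_S: "(\<Sum>s\<in>S. w s * g s) = (\<Sum>a\<in>K. \<Sum>b\<in>K. w' (a, b) * g (a, b))" for g :: "_ \<Rightarrow> real"
    proof -
      have "(\<Sum>s\<in>S. w s * g s) = (\<Sum>s\<in>K \<times> K. w' s * g s)"
        using K S by (intro sum.mono_neutral_cong_left) (auto simp: w'_def)
      then show ?thesis
        by (simp add: sum.cartesian_product)
    qed
    have "(\<Sum>b\<in>K. w' (a, b)) = 0" if "a \<in> K" for a
    proof -
      have "0 = (\<Sum>x\<in>K. \<Sum>b\<in>K. w' (x, b) * m (Inl a) (x, b))"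
        using w[OF InlI[OF that]] by (simp add: sum_S)
      also have "\<dots> = (\<Sum>x\<in>K. if x = a then \<Sum>b\<in>K. w' (x, b) else 0)"
        by (intro sum.cong) (auto simp: m_def)
      finally show ?thesis
        using that K by simp
    qed
    moreover have "(\<Sum>a\<in>K. w' (a, b)) = 0" if "b \<in> K" for b
    proof -
      have "0 = (\<Sum>x\<in>K. \<Sum>y\<in>K. w' (x, y) * m (Inr b) (x, y))"
        using w[OF InrI[OF that]] by (simp add: sum_S)
      also have "\<dots> = (\<Sum>y\<in>K. if y = b then \<Sum>x\<in>K. w' (x, y) else 0)"
        by (subst sum.swap, intro sum.cong) (auto simp: m_def)
      finally show ?thesis
        using that K by simp
    qed
    ultimately have "\<forall>s. w' s = 0"
      using free unfolding circulation_free_def circulation_def by (metis w'_def)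
    then show "\<forall>s\<in>S. w s = 0"
      by (metis w'_def)
  qed (use K fS in auto)
  then obtain u where u: "\<And>s. s \<in> S \<Longrightarrow> (\<Sum>j\<in>K <+> K. u j * m j s) = case_prod c s"
    by blast
  have "u (Inl a) + u (Inr b) = c a b" if "(a, b) \<in> S" for a b
  proof -
    have ab: "a \<in> K" "b \<in> K"
      using that S by auto
    have "c a b = (\<Sum>x\<in>K. u (Inl x) * of_bool (a = x)) + (\<Sum>x\<in>K. u (Inr x) * of_bool (b = x))"
      using u[OF that] K by (simp add: sum.Plus m_def comp_def)
    also have "(\<Sum>x\<in>K. u (Inl x) * of_bool (a = x)) = u (Inl a)"
      using K ab by (simp add: of_bool_def if_distrib[of "\<lambda>x. _ * x"] cong: if_cong)
    also have "(\<Sum>x\<in>K. u (Inr x) * of_bool (b = x)) = u (Inr b)"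
      using K ab by (simp add: of_bool_def if_distrib[of "\<lambda>x. _ * x"] cong: if_cong)
    finally show ?thesis by simp
  qed
  then show ?thesis
    by (intro exI[of _ "\<lambda>a. u (Inl a)"] exI[of _ "\<lambda>b. u (Inr b)"]) auto
qed

text \<open>Pairs off the support carry no mass, so \<open>c a b\<close> may be replaced by
  \<open>u a + v b\<close> under the sum. Summing over rows and columns then leaves only the
  marginals.\<close>

lemma transport_cost_potentials:
  assumes pl: "transport_plan K p q \<pi>" and uv: "\<forall>(a, b)\<in>{s. \<pi> s \<noteq> 0}. u a + v b = c a b"
  shows "transport_cost K c \<pi> = (\<Sum>a\<in>K. u a * p a + v a * q a)"
proof -
  have "transport_cost K c \<pi> = (\<Sum>a\<in>K. \<Sum>b\<in>K. u a * \<pi> (a, b) + v b * \<pi> (a, b))"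
    unfolding transport_cost_def
  proof (intro sum.cong refl)
    fix a b
    show "c a b * \<pi> (a, b) = u a * \<pi> (a, b) + v b * \<pi> (a, b)"
      using uv by (cases "\<pi> (a, b) = 0") (auto simp flip: distrib_right)
  qed
  also have "\<dots> = (\<Sum>a\<in>K. u a * (\<Sum>b\<in>K. \<pi> (a, b))) + (\<Sum>b\<in>K. v b * (\<Sum>a\<in>K. \<pi> (a, b)))"
    by (simp add: sum.distrib sum_distrib_left) (rule sum.swap)
  also have "\<dots> = (\<Sum>a\<in>K. u a * p a) + (\<Sum>b\<in>K. v b * q b)"
    using pl by (simp add: transport_plan_def)
  finally show ?thesis
    by (simp add: sum.distrib)
qed

text \<open>The order of quantifiers is the point: \<open>F\<close> depends on \<open>K\<close> and
  \<open>c\<close> alone, so one finite family later serves all times. It arises by fixing one pair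
  of potentials for each possible support.\<close>

lemma transport_value_finitely_many_functionals:
  fixes c :: "'v \<Rightarrow> 'v \<Rightarrow> real"
  assumes K: "finite K"
  shows "\<exists>F. finite F \<and> (\<forall>p q. Ex (transport_plan K p q) \<longrightarrow>
    (\<exists>(u, v)\<in>F. Inf (transport_cost K c ` Collect (transport_plan K p q))
       = (\<Sum>a\<in>K. u a * p a + v a * q a)))"
proof -
  \<comment> \<open>On a set without potentials the choice is arbitrary. Such values merely enlarge
    \<open>F\<close>; only circulation-free supports are evaluated.\<close>
  define G where "G S = (SOME g. \<forall>(a, b)\<in>S. fst g a + snd g b = c a b)" for S
  have G: "\<forall>(a, b)\<in>S. fst (G S) a + snd (G S) b = c a b"
    if S: "S \<subseteq> K \<times> K" "circulation_free K S" for S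
  proof -
    obtain u v where "\<forall>(a, b)\<in>S. u a + v b = c a b"
      using circulation_free_potentials[OF K S] by blast
    then have "\<forall>(a, b)\<in>S. fst (u, v) a + snd (u, v) b = c a b"
      by simp
    then show ?thesis
      unfolding G_def by (rule someI)
  qed
  define F where "F = G ` Pow (K \<times> K)"
  have fF: "finite F"
    using K by (simp add: F_def)
  have "\<exists>(u, v)\<in>F. Inf (transport_cost K c ` Collect (transport_plan K p q))
       = (\<Sum>a\<in>K. u a * p a + v a * q a)" if ex: "Ex (transport_plan K p q)" for p q
  proof -
    \<comment> \<open>The costs \<open>C\<close> of these reduced plans form a finite set, since
      each is the value of a functional in \<open>F\<close>. Every plan costs at least as much as
      some reduced one, so the infimum is attained and equals \<open>Min C\<close>.\<close>
    define B where "B = {\<pi>. transport_plan K p q \<pi> \<and> circulation_free K {s. \<pi> s \<noteq> 0}}"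
    define C where "C = transport_cost K c ` B"
    have in_F: "\<exists>(u, v)\<in>F. x = (\<Sum>a\<in>K. u a * p a + v a * q a)" if xC: "x \<in> C" for x
    proof -
      obtain \<pi> where \<pi>: "transport_plan K p q \<pi>" "circulation_free K {s. \<pi> s \<noteq> 0}"
        "x = transport_cost K c \<pi>"
        using xC unfolding C_def B_def by blast
      define S where "S = {s. \<pi> s \<noteq> 0}"
      have S: "S \<subseteq> K \<times> K"
        using \<pi> by (auto simp: transport_plan_def S_def)
      then have "x = (\<Sum>a\<in>K. fst (G S) a * p a + snd (G S) a * q a)"
        using transport_cost_potentials[OF \<pi>(1)] G[OF S] \<pi> by (simp add: S_def)
      then show ?thesis
        using S by (intro bexI[of _ "G S"]) (auto simp: F_def case_prod_beta)
    qed
    then have "C \<subseteq> (\<lambda>(u, v). \<Sum>a\<in>K. u a * p a + v a * q a) ` F"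
      by (force simp: image_def)
    then have fC: "finite C"
      using fF finite_surj by blast
    have reduce: "\<exists>x\<in>C. x \<le> transport_cost K c \<pi>" if "transport_plan K p q \<pi>" for \<pi>
      using transport_plan_reduce_support[OF K that, of c] by (auto simp: C_def B_def)
    then have neC: "C \<noteq> {}"
      using ex by blast
    have "Inf (transport_cost K c ` Collect (transport_plan K p q)) = Min C"
    proof (rule cInf_eq_minimum)
      show "Min C \<in> transport_cost K c ` Collect (transport_plan K p q)"
        using Min_in[OF fC neC] by (auto simp: C_def B_def)
      show "Min C \<le> x" if "x \<in> transport_cost K c ` Collect (transport_plan K p q)" for x
        using that reduce fC by (auto simp: Min_le_iff neC)
    qed
    then show ?thesis
      using in_F[OF Min_in[OF fC neC]] by simp
  qed
  then show ?thesis
    using fF by blast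
qed

section \<open>The Wasserstein distance of finitely supported measures\<close>

text \<open>The gluing construction: \<open>\<kappa> a b e\<close> is the joint mass that makes
  \<open>a\<close> and \<open>e\<close> conditionally independent given the middle point
  \<open>b\<close>. Its two adjacent marginals are \<open>\<pi>\<close> and \<open>\<sigma>\<close>,
  and forgetting \<open>b\<close> gives \<open>\<tau>\<close>.\<close>

lemma transport_plan_glue:
  assumes K: "finite K" and \<pi>: "transport_plan K p q \<pi>" and \<sigma>: "transport_plan K q r \<sigma>"
    and tri: "\<And>x y z. c x z \<le> c x y + c y z"
  shows "\<exists>\<tau>. transport_plan K p r \<tau> \<and>
    transport_cost K c \<tau> \<le> transport_cost K c \<pi> + transport_cost K c \<sigma>"
proof -
  \<comment> \<open>Where \<open>q b = 0\<close> both plans vanish, so the junk value of the quotient is harmless.\<close>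
  define \<kappa> where "\<kappa> a b e = \<pi> (a, b) * \<sigma> (b, e) / q b" for a b e
  define \<tau> where "\<tau> s = (\<Sum>b\<in>K. \<kappa> (fst s) b (snd s))" for s
  have \<pi>0: "\<pi> (a, b) \<ge> 0" and \<sigma>0: "\<sigma> (a, b) \<ge> 0" for a b
    using \<pi> \<sigma> by (auto simp: transport_plan_def)
  have rows: "(\<Sum>e\<in>K. \<sigma> (b, e)) = q b" and cols: "(\<Sum>a\<in>K. \<pi> (a, b)) = q b" if "b \<in> K" for b
    using \<pi> \<sigma> that by (auto simp: transport_plan_def)
  have q0: "q b \<ge> 0" if "b \<in> K" for b
    unfolding cols[OF that, symmetric] by (intro sum_nonneg \<pi>0)
  have \<kappa>0: "\<kappa> a b e \<ge> 0" if "b \<in> K" for a b e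
    using q0[OF that] \<pi>0 \<sigma>0 by (simp add: \<kappa>_def)
  have sum_right: "(\<Sum>e\<in>K. \<kappa> a b e) = \<pi> (a, b)" if "a \<in> K" "b \<in> K" for a b
  proof -
    have "(\<Sum>e\<in>K. \<kappa> a b e) = \<pi> (a, b) * q b / q b"
      by (simp add: \<kappa>_def rows[OF that(2), symmetric] sum_distrib_left sum_divide_distrib)
    moreover have "\<pi> (a, b) = 0" if "q b = 0"
      using cols[OF \<open>b \<in> K\<close>] that K \<pi>0 \<open>a \<in> K\<close> by (simp add: sum_nonneg_eq_0_iff)
    ultimately show ?thesis by auto
  qed
  have sum_left: "(\<Sum>a\<in>K. \<kappa> a b e) = \<sigma> (b, e)" if "e \<in> K" "b \<in> K" for b e
  proof -
    have "(\<Sum>a\<in>K. \<kappa> a b e) = q b * \<sigma> (b, e) / q b"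
      by (simp add: \<kappa>_def cols[OF that(2), symmetric] sum_distrib_right sum_divide_distrib)
    moreover have "\<sigma> (b, e) = 0" if "q b = 0"
      using rows[OF \<open>b \<in> K\<close>] that K \<sigma>0 \<open>e \<in> K\<close> by (simp add: sum_nonneg_eq_0_iff)
    ultimately show ?thesis by auto
  qed
  have "transport_plan K p r \<tau>"
    unfolding transport_plan_def
  proof (intro conjI allI ballI impI)
    show "\<tau> s \<ge> 0" for s
      by (auto simp: \<tau>_def intro!: sum_nonneg \<kappa>0)
    show "\<tau> s = 0" if "s \<notin> K \<times> K" for s
    proof -
      have "\<kappa> (fst s) b (snd s) = 0" for b
        using that \<pi> \<sigma> by (cases s) (auto simp: \<kappa>_def transport_plan_def)
      then show ?thesis
        by (simp add: \<tau>_def)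
    qed
    show "(\<Sum>e\<in>K. \<tau> (a, e)) = p a" if "a \<in> K" for a
      using that \<pi> sum_right[OF that] unfolding \<tau>_def
      by (subst sum.swap) (simp add: transport_plan_def)
    show "(\<Sum>a\<in>K. \<tau> (a, e)) = r e" if "e \<in> K" for e
      using that \<sigma> sum_left[OF that] unfolding \<tau>_def
      by (subst sum.swap) (simp add: transport_plan_def)
  qed
  moreover have "transport_cost K c \<tau> \<le> transport_cost K c \<pi> + transport_cost K c \<sigma>"
  proof -
    have "transport_cost K c \<tau> = (\<Sum>a\<in>K. \<Sum>e\<in>K. \<Sum>b\<in>K. c a e * \<kappa> a b e)"
      by (simp add: transport_cost_def \<tau>_def sum_distrib_left)
    also have "\<dots> \<le> (\<Sum>a\<in>K. \<Sum>e\<in>K. \<Sum>b\<in>K. (c a b + c b e) * \<kappa> a b e)"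
      by (intro sum_mono mult_right_mono tri \<kappa>0)
    also have "\<dots> = (\<Sum>a\<in>K. \<Sum>e\<in>K. \<Sum>b\<in>K. c a b * \<kappa> a b e)
        + (\<Sum>a\<in>K. \<Sum>e\<in>K. \<Sum>b\<in>K. c b e * \<kappa> a b e)"
      by (simp add: distrib_right sum.distrib)
    also have "(\<Sum>a\<in>K. \<Sum>e\<in>K. \<Sum>b\<in>K. c a b * \<kappa> a b e)
        = (\<Sum>a\<in>K. \<Sum>b\<in>K. c a b * (\<Sum>e\<in>K. \<kappa> a b e))"
      by (subst sum.swap) (simp add: sum_distrib_left)
    also have "\<dots> = transport_cost K c \<pi>"
      by (simp add: transport_cost_def sum_right)
    also have "(\<Sum>a\<in>K. \<Sum>e\<in>K. \<Sum>b\<in>K. c b e * \<kappa> a b e)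
        = (\<Sum>e\<in>K. \<Sum>b\<in>K. c b e * (\<Sum>a\<in>K. \<kappa> a b e))"
      by (subst sum.swap, rule sum.cong[OF refl], subst sum.swap) (simp add: sum_distrib_left)
    also have "\<dots> = (\<Sum>e\<in>K. \<Sum>b\<in>K. c b e * \<sigma> (b, e))"
      by (simp add: sum_left)
    also have "\<dots> = transport_cost K c \<sigma>"
      unfolding transport_cost_def by (rule sum.swap)
    finally show ?thesis .
  qed
  ultimately show ?thesis by blast
qed

section \<open>Couplings of probability mass functions as transport plans\<close>

lemma pmf_map_fst_finite:
  assumes K: "finite K" and "set_pmf \<pi> \<subseteq> K \<times> K"
  shows "pmf (map_pmf fst \<pi>) a = (\<Sum>b\<in>K. pmf \<pi> (a, b))"
proof -
  have "pmf (map_pmf fst \<pi>) a = measure \<pi> (fst -` {a} \<inter> set_pmf \<pi>)"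
    by (simp add: pmf_map measure_Int_set_pmf)
  also have "\<dots> = measure \<pi> (Pair a ` K \<inter> set_pmf \<pi>)"
    using assms(2) by (intro arg_cong[of _ _ "measure \<pi>"]) auto
  also have "\<dots> = (\<Sum>b\<in>K. pmf \<pi> (a, b))"
    using K by (simp add: measure_Int_set_pmf measure_measure_pmf_finite sum.reindex inj_on_def)
  finally show ?thesis .
qed

lemma pmf_map_snd_finite:
  assumes K: "finite K" and "set_pmf \<pi> \<subseteq> K \<times> K"
  shows "pmf (map_pmf snd \<pi>) b = (\<Sum>a\<in>K. pmf \<pi> (a, b))"
proof -
  have "pmf (map_pmf snd \<pi>) b = measure \<pi> (snd -` {b} \<inter> set_pmf \<pi>)"
    by (simp add: pmf_map measure_Int_set_pmf)
  also have "\<dots> = measure \<pi> ((\<lambda>a. (a, b)) ` K \<inter> set_pmf \<pi>)"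
    using assms(2) by (intro arg_cong[of _ _ "measure \<pi>"]) auto
  also have "\<dots> = (\<Sum>a\<in>K. pmf \<pi> (a, b))"
    using K by (simp add: measure_Int_set_pmf measure_measure_pmf_finite sum.reindex inj_on_def)
  finally show ?thesis .
qed

lemma expectation_coupling_finite:
  assumes K: "finite K" and "set_pmf \<pi> \<subseteq> K \<times> K"
  shows "measure_pmf.expectation \<pi> (\<lambda>(a, b). d a b) = transport_cost K d (pmf \<pi>)"
proof -
  have "measure_pmf.expectation \<pi> (\<lambda>(a, b). d a b) = (\<Sum>s\<in>K \<times> K. (case s of (a, b) \<Rightarrow> d a b) * pmf \<pi> s)"
    using assms by (intro integral_measure_pmf_real) auto
  then show ?thesis
    by (simp add: transport_cost_def sum.cartesian_product case_prod_beta)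
qed

text \<open>Both infima range over the same set of costs. The mass function of a coupling is a plan
  because its support projects into \<open>K\<close> on both sides; conversely a plan has total mass
  1 and defines a coupling through \<open>embed_pmf\<close>.\<close>

lemma W1_eq_transport_value:
  assumes K: "finite K" and \<mu>: "set_pmf \<mu> \<subseteq> K" and \<nu>: "set_pmf \<nu> \<subseteq> K"
  shows "W1 d \<mu> \<nu> = Inf (transport_cost K d ` Collect (transport_plan K (pmf \<mu>) (pmf \<nu>)))"
proof -
  have "{measure_pmf.expectation \<pi> (\<lambda>(a,b). d a b) | \<pi>. map_pmf fst \<pi> = \<mu> \<and> map_pmf snd \<pi> = \<nu>}
      = transport_cost K d ` Collect (transport_plan K (pmf \<mu>) (pmf \<nu>))" (is "?L = ?R")
  proof (intro equalityI subsetI)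
    fix x assume "x \<in> ?L"
    then obtain \<pi> where \<pi>: "map_pmf fst \<pi> = \<mu>" "map_pmf snd \<pi> = \<nu>"
      "x = measure_pmf.expectation \<pi> (\<lambda>(a,b). d a b)"
      by blast
    have "fst ` set_pmf \<pi> \<subseteq> K" "snd ` set_pmf \<pi> \<subseteq> K"
      using \<mu> \<nu> \<pi> by (auto simp flip: set_map_pmf)
    then have sup: "set_pmf \<pi> \<subseteq> K \<times> K"
      by force
    have "pmf \<pi> s = 0" if "s \<notin> K \<times> K" for s
      using that sup by (metis pmf_eq_0_set_pmf subsetD)
    then have "transport_plan K (pmf \<mu>) (pmf \<nu>) (pmf \<pi>)"
      by (simp add: transport_plan_def pmf_map_fst_finite[OF K sup, symmetric]
          pmf_map_snd_finite[OF K sup, symmetric] \<pi>)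
    then show "x \<in> ?R"
      using expectation_coupling_finite[OF K sup] \<pi>(3) by auto
  next
    fix x assume "x \<in> ?R"
    then obtain \<rho> where \<rho>: "transport_plan K (pmf \<mu>) (pmf \<nu>) \<rho>" "x = transport_cost K d \<rho>"
      by blast
    have supp: "{s. \<rho> s \<noteq> 0} \<subseteq> K \<times> K"
      using \<rho> by (auto simp: transport_plan_def)
    \<comment> \<open>The first marginal alone already fixes the total mass of
      \<open>\<rho>\<close>.\<close>
    have "(\<Sum>s\<in>K \<times> K. \<rho> s) = (\<Sum>a\<in>K. \<Sum>b\<in>K. \<rho> (a, b))"
      by (simp add: sum.cartesian_product)
    also have "\<dots> = (\<Sum>a\<in>K. pmf \<mu> a)"
      using \<rho> by (simp add: transport_plan_def)
    also have "\<dots> = 1"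
      using sum_pmf_eq_1[OF K \<mu>] .
    finally have one: "(\<Sum>s\<in>K \<times> K. \<rho> s) = 1" .
    have "(\<integral>\<^sup>+ s. ennreal (\<rho> s) \<partial>count_space UNIV) = (\<Sum>s\<in>K \<times> K. ennreal (\<rho> s))"
      using K supp by (intro nn_integral_count_space') (auto dest!: subsetD[of _ _ "(_, _)"])
    also have "\<dots> = 1"
      using one \<rho> by (subst sum_ennreal) (auto simp: transport_plan_def)
    finally have pmf_emb: "pmf (embed_pmf \<rho>) = \<rho>"
      using \<rho> by (intro ext pmf_embed_pmf) (auto simp: transport_plan_def)
    then have sup: "set_pmf (embed_pmf \<rho>) \<subseteq> K \<times> K"
      using supp by (simp add: set_pmf_eq)
    have "map_pmf fst (embed_pmf \<rho>) = \<mu>"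
    proof (rule pmf_eqI)
      fix a
      show "pmf (map_pmf fst (embed_pmf \<rho>)) a = pmf \<mu> a"
      proof (cases "a \<in> K")
        case True
        then show ?thesis
          using \<rho> by (simp add: pmf_map_fst_finite[OF K sup] pmf_emb transport_plan_def)
      next
        \<comment> \<open>A plan prescribes its marginals on \<open>K\<close> only; at points
          outside \<open>K\<close> both sides are 0, by the zero extension of \<open>\<rho>\<close>
          and the support of \<open>\<mu>\<close>.\<close>
        case False
        then show ?thesis
          using \<rho> \<mu> by (simp add: pmf_map_fst_finite[OF K sup] pmf_emb transport_plan_def)
            (metis pmf_eq_0_set_pmf subsetD)
      qed
    qed
    moreover have "map_pmf snd (embed_pmf \<rho>) = \<nu>"
    proof (rule pmf_eqI)
      fix a
      show "pmf (map_pmf snd (embed_pmf \<rho>)) a = pmf \<nu> a"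
      proof (cases "a \<in> K")
        case True
        then show ?thesis
          using \<rho> by (simp add: pmf_map_snd_finite[OF K sup] pmf_emb transport_plan_def)
      next
        case False
        then show ?thesis
          using \<rho> \<nu> by (simp add: pmf_map_snd_finite[OF K sup] pmf_emb transport_plan_def)
            (metis pmf_eq_0_set_pmf subsetD)
      qed
    qed
    moreover have "x = measure_pmf.expectation (embed_pmf \<rho>) (\<lambda>(a,b). d a b)"
      using expectation_coupling_finite[OF K sup] \<rho>(2) by (simp add: pmf_emb)
    ultimately show "x \<in> ?L"
      by blast
  qed
  then show ?thesis
    by (simp add: W1_def)
qed

text \<open>The independent coupling. It keeps the sets under \<open>Inf\<close> nonempty, without
  which the infimum carries no information.\<close>

lemma transport_plan_exists:
  assumes K: "finite K" and \<mu>: "set_pmf \<mu> \<subseteq> K" and \<nu>: "set_pmf \<nu> \<subseteq> K"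
  shows "Ex (transport_plan K (pmf \<mu>) (pmf \<nu>))"
proof
  have "pmf \<mu> a * pmf \<nu> b = 0" if "\<not> (a \<in> K \<and> b \<in> K)" for a b
    using that \<mu> \<nu> by (metis mult_eq_0_iff pmf_eq_0_set_pmf subsetD)
  then show "transport_plan K (pmf \<mu>) (pmf \<nu>) (\<lambda>(a, b). pmf \<mu> a * pmf \<nu> b)"
    using sum_pmf_eq_1[OF K \<mu>] sum_pmf_eq_1[OF K \<nu>]
    by (auto simp: transport_plan_def simp flip: sum_distrib_left sum_distrib_right)
qed

lemma W1_finitely_many_functionals:
  fixes d :: "'v \<Rightarrow> 'v \<Rightarrow> real"
  assumes K: "finite K"
  shows "\<exists>F. finite F \<and> (\<forall>\<mu> \<nu>. set_pmf \<mu> \<subseteq> K \<longrightarrow> set_pmf \<nu> \<subseteq> K \<longrightarrow>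
    (\<exists>(u, v)\<in>F. W1 d \<mu> \<nu> = (\<Sum>a\<in>K. u a * pmf \<mu> a + v a * pmf \<nu> a)))"
proof -
  obtain F where F: "finite F" "\<And>p q. Ex (transport_plan K p q) \<Longrightarrow>
      \<exists>(u, v)\<in>F. Inf (transport_cost K d ` Collect (transport_plan K p q))
         = (\<Sum>a\<in>K. u a * p a + v a * q a)"
    using transport_value_finitely_many_functionals[OF K, of d] by blast
  have "\<exists>(u, v)\<in>F. W1 d \<mu> \<nu> = (\<Sum>a\<in>K. u a * pmf \<mu> a + v a * pmf \<nu> a)"
    if "set_pmf \<mu> \<subseteq> K" "set_pmf \<nu> \<subseteq> K" for \<mu> \<nu>
    using F(2)[OF transport_plan_exists[OF K that]] by (simp add: W1_eq_transport_value[OF K that])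
  then show ?thesis
    using F(1) by blast
qed

lemma W1_triangle:
  assumes d: "Metric_space UNIV d" and K: "finite K"
    and \<mu>: "set_pmf \<mu> \<subseteq> K" and \<nu>: "set_pmf \<nu> \<subseteq> K" and \<rho>: "set_pmf \<rho> \<subseteq> K"
  shows "W1 d \<mu> \<rho> \<le> W1 d \<mu> \<nu> + W1 d \<nu> \<rho>"
proof -
  interpret Metric_space UNIV d by (fact d)
  define C where "C \<mu> \<nu> = transport_cost K d ` Collect (transport_plan K (pmf \<mu>) (pmf \<nu>))" for \<mu> \<nu>
  have bdd: "bdd_below (C \<mu> \<nu>)" for \<mu> \<nu>
    unfolding C_def
    by (rule bdd_belowI[of _ 0]) (auto simp: transport_cost_def transport_plan_def intro!: sum_nonneg)
  have ne: "C \<mu> \<nu> \<noteq> {}" if "set_pmf \<mu> \<subseteq> K" "set_pmf \<nu> \<subseteq> K" for \<mu> \<nu>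
    using transport_plan_exists[OF K that] by (auto simp: C_def)
  have glue: "Inf (C \<mu> \<rho>) \<le> x + y" if "x \<in> C \<mu> \<nu>" "y \<in> C \<nu> \<rho>" for x y
  proof -
    obtain \<pi> \<sigma> where "transport_plan K (pmf \<mu>) (pmf \<nu>) \<pi>" "x = transport_cost K d \<pi>"
        "transport_plan K (pmf \<nu>) (pmf \<rho>) \<sigma>" "y = transport_cost K d \<sigma>"
      using \<open>x \<in> _\<close> \<open>y \<in> _\<close> by (auto simp: C_def)
    then obtain \<tau> where "transport_plan K (pmf \<mu>) (pmf \<rho>) \<tau>" "transport_cost K d \<tau> \<le> x + y"
      using transport_plan_glue[OF K, of "pmf \<mu>" "pmf \<nu>" \<pi> "pmf \<rho>" \<sigma> d] triangle by auto
    then show ?thesis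
      using bdd by (intro cInf_lower2[of "transport_cost K d \<tau>"]) (auto simp: C_def)
  qed
  \<comment> \<open>The infimum is taken over the first plan with the second cost \<open>y\<close>
    fixed, then over \<open>y\<close>, so no optimal plan has to be chosen.\<close>
  have "Inf (C \<mu> \<rho>) - y \<le> Inf (C \<mu> \<nu>)" if "y \<in> C \<nu> \<rho>" for y
    using glue[OF _ that] by (intro cInf_greatest ne \<mu> \<nu>) (simp add: diff_le_eq)
  then have "Inf (C \<mu> \<rho>) - Inf (C \<mu> \<nu>) \<le> Inf (C \<nu> \<rho>)"
    by (intro cInf_greatest ne \<nu> \<rho>) (simp add: algebra_simps)
  then show ?thesis
    using K \<mu> \<nu> \<rho> by (simp add: W1_eq_transport_value C_def)
qed

text \<open>Swapping the coordinates of a coupling exchanges its marginals and, by symmetry of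
  \<open>d\<close>, preserves its cost.\<close>

lemma W1_commute:
  assumes "Metric_space UNIV d"
  shows "W1 d \<mu> \<nu> = W1 d \<nu> \<mu>"
proof -
  have comm: "d a b = d b a" for a b
    using assms by (simp add: Metric_space.commute)
  have *: "\<exists>\<pi>'. measure_pmf.expectation \<pi> (\<lambda>(a, b). d a b) = measure_pmf.expectation \<pi>' (\<lambda>(a, b). d a b)
      \<and> map_pmf fst \<pi>' = map_pmf snd \<pi> \<and> map_pmf snd \<pi>' = map_pmf fst \<pi>" for \<pi>
    by (intro exI[of _ "map_pmf prod.swap \<pi>"])
      (simp add: pmf.map_comp comp_def case_prod_unfold comm[of "snd _" "fst _"])
  show ?thesis
    unfolding W1_def by (intro arg_cong[of _ _ Inf] Collect_cong) (metis *)
qed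

text \<open>One bound passes through the pair \<open>\<mu>'\<close>, \<open>\<nu>\<close>, the other
  through \<open>\<mu>\<close>, \<open>\<nu>'\<close>. This separates the two measures, as the
  continuity of a walk speaks of one vertex at a time.\<close>

lemma abs_W1_diff_le:
  assumes d: "Metric_space UNIV d" and K: "finite K"
    and "set_pmf \<mu> \<subseteq> K" "set_pmf \<nu> \<subseteq> K" "set_pmf \<mu>' \<subseteq> K" "set_pmf \<nu>' \<subseteq> K"
  shows "\<bar>W1 d \<mu> \<nu> - W1 d \<mu>' \<nu>'\<bar> \<le> W1 d \<mu> \<mu>' + W1 d \<nu> \<nu>'"
proof -
  note tri = W1_triangle[OF d K]
  show ?thesis
    using tri[OF assms(3,5,4)] tri[OF assms(5,6,4)] tri[OF assms(5,3,6)] tri[OF assms(3,4,6)]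
    unfolding W1_commute[OF d, of \<mu>' \<mu>] W1_commute[OF d, of \<nu>' \<nu>] by linarith
qed

lemma continuous_on_W1_walk:
  assumes d: "Metric_space UNIV d" and rw: "random_walk d mu" and K: "finite K"
    and sup: "\<And>t. t \<in> {0..1} \<Longrightarrow> set_pmf (mu x t) \<subseteq> K" "\<And>t. t \<in> {0..1} \<Longrightarrow> set_pmf (mu y t) \<subseteq> K"
  shows "continuous_on {0..1} (\<lambda>t. W1 d (mu x t) (mu y t))"
  unfolding continuous_on_def
proof
  fix s :: real assume s: "s \<in> {0..1}"
  have "((\<lambda>t. W1 d (mu x t) (mu x s) + W1 d (mu y t) (mu y s)) \<longlongrightarrow> 0) (at s within {0..1})"
    using rw s unfolding random_walk_def by (intro tendsto_add_zero) blast+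
  then have "((\<lambda>t. W1 d (mu x t) (mu y t) - W1 d (mu x s) (mu y s)) \<longlongrightarrow> 0) (at s within {0..1})"
  proof (rule Lim_null_comparison[rotated])
    show "\<forall>\<^sub>F t in at s within {0..1}. norm (W1 d (mu x t) (mu y t) - W1 d (mu x s) (mu y s))
        \<le> W1 d (mu x t) (mu x s) + W1 d (mu y t) (mu y s)"
      unfolding eventually_at_filter
    proof (intro always_eventually allI impI)
      fix t :: real assume "t \<in> {0..1}"
      then show "norm (W1 d (mu x t) (mu y t) - W1 d (mu x s) (mu y s))
        \<le> W1 d (mu x t) (mu x s) + W1 d (mu y t) (mu y s)"
        unfolding real_norm_def using s by (intro abs_W1_diff_le[OF d K] sup)
    qed
  qed
  then show "((\<lambda>t. W1 d (mu x t) (mu y t)) \<longlongrightarrow> W1 d (mu x s) (mu y s)) (at s within {0..1})"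
    by (rule LIM_zero_cancel)
qed

section \<open>Continuous selections and real analytic functions\<close>

text \<open>Connectedness of the open interval: the set where \<open>f\<close> agrees with a given
  \<open>h\<close> is closed, and its complement is a finite union of closed sets, hence closed too.
  The endpoints follow by continuity.\<close>

lemma continuous_selection_eq_on_interval:
  fixes f :: "real \<Rightarrow> real"
  assumes "a < b" and H: "finite H" and f: "continuous_on {a..b} f"
    and cont: "\<And>h. h \<in> H \<Longrightarrow> continuous_on {a..b} h"
    and sel: "\<And>s. s \<in> {a..b} \<Longrightarrow> \<exists>h\<in>H. f s = h s"
    and sep: "\<And>h g s. h \<in> H \<Longrightarrow> g \<in> H \<Longrightarrow> s \<in> {a<..<b} \<Longrightarrow> h s = g s \<Longrightarrow> (\<forall>s\<in>{a<..<b}. h s = g s)"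
  shows "\<exists>h\<in>H. \<forall>s\<in>{a..b}. f s = h s"
proof -
  define I where "I = {a<..<b}"
  have sub: "I \<subseteq> {a..b}"
    by (auto simp: I_def)
  define m where "m = (a + b) / 2"
  have m: "m \<in> I"
    using \<open>a < b\<close> by (simp add: m_def I_def)
  obtain h where h: "h \<in> H" "f m = h m"
    using sel m sub by blast
  have closed: "closedin (top_of_set I) {s \<in> I. f s = g s}" if "g \<in> H" for g
  proof -
    have "continuous_on I (\<lambda>s. f s - g s)"
      using f cont[OF that] sub by (intro continuous_on_diff) (auto intro: continuous_on_subset)
    from continuous_closedin_preimage_constant[OF this, of 0] show ?thesis
      by simp
  qed
  \<comment> \<open>By \<open>sep\<close>, a member of \<open>D\<close> differs from
    \<open>h\<close> at every point of \<open>I\<close>; functions in \<open>H\<close> that coincide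
    with \<open>h\<close> on \<open>I\<close> under another name are left out.\<close>
  define D where "D = {g \<in> H. \<exists>s\<in>I. g s \<noteq> h s}"
  have "I - {s \<in> I. f s = h s} = (\<Union>g\<in>D. {s \<in> I. f s = g s})"
  proof (intro equalityI subsetI)
    fix s assume s: "s \<in> I - {s \<in> I. f s = h s}"
    then obtain g where "g \<in> H" "f s = g s"
      using sel sub by blast
    then show "s \<in> (\<Union>g\<in>D. {s \<in> I. f s = g s})"
      using s by (auto simp: D_def)
  next
    fix s assume "s \<in> (\<Union>g\<in>D. {s \<in> I. f s = g s})"
    then obtain g where g: "g \<in> H" "\<exists>s\<in>I. g s \<noteq> h s" "s \<in> I" "f s = g s"
      by (auto simp: D_def)
    then have "g s \<noteq> h s"
      using sep[OF g(1) h(1), of s] unfolding I_def by blast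
    then show "s \<in> I - {s \<in> I. f s = h s}"
      using g by simp
  qed
  moreover have "closedin (top_of_set I) (\<Union>g\<in>D. {s \<in> I. f s = g s})"
    using H closed by (intro closedin_Union) (auto simp: D_def)
  ultimately have "openin (top_of_set I) {s \<in> I. f s = h s}"
    by (simp add: openin_closedin_eq)
  moreover have "connected I"
    by (simp add: I_def)
  ultimately have "{s \<in> I. f s = h s} = {} \<or> {s \<in> I. f s = h s} = I"
    using closed[OF h(1)] unfolding connected_clopen by blast
  then have eq: "f s - h s = 0" if "s \<in> I" for s
    using that m h by auto
  have cl: "closure I = {a..b}"
    using \<open>a < b\<close> by (simp add: I_def)
  have "f s - h s = 0" if "s \<in> {a..b}" for s
    using continuous_constant_on_closure[of I "\<lambda>s. f s - h s" 0 s] f cont[OF h(1)] that eq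
    unfolding cl by (auto intro: continuous_on_diff)
  then show ?thesis
    using h by auto
qed

lemma piecewise_on_unit_finite_selection:
  assumes H: "finite H" and f: "continuous_on {0..1} f"
    and cont: "\<And>h. h \<in> H \<Longrightarrow> continuous_on {0..1} h"
    and sel: "\<And>s. s \<in> {0..1} \<Longrightarrow> \<exists>h\<in>H. f s = h s"
    and coincide: "\<And>h g. h \<in> H \<Longrightarrow> g \<in> H \<Longrightarrow>
      finite {s \<in> {0..1}. h s = g s} \<or> (\<forall>s\<in>{0..1}. h s = g s)"
    and P: "\<And>h a b. h \<in> H \<Longrightarrow> 0 \<le> a \<Longrightarrow> a < b \<Longrightarrow> b \<le> 1 \<Longrightarrow> P h a b"
  shows "piecewise_on_unit P f"
proof -
  \<comment> \<open>The breakpoints. Pairs that agree throughout the interval have an infinite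
    coincidence set and contribute none, so \<open>Z\<close> is finite, and inside a gap of
    \<open>Z\<close> two members of \<open>H\<close> agree everywhere or nowhere.\<close>
  define Z where "Z = {0, 1} \<union> (\<Union>(h, g)\<in>{(h, g) \<in> H \<times> H. finite {s \<in> {0..1}. h s = g s}}.
      {s \<in> {0..1}. h s = g s})"
  have "finite {(h, g) \<in> H \<times> H. finite {s \<in> {0..1}. h s = g s}}"
    using H by (auto intro: finite_subset[of _ "H \<times> H"])
  then have fZ: "finite Z"
    unfolding Z_def by auto
  have Z01: "Z \<subseteq> {0..1}" "0 \<in> Z" "1 \<in> Z"
    by (auto simp: Z_def)
  define xs where "xs = sorted_list_of_set Z"
  have set_xs: "set xs = Z" and sorted: "sorted_wrt (<) xs"
    using fZ by (simp_all add: xs_def)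
  have mono: "xs ! i < xs ! j" if "i < j" "j < length xs" for i j
    using sorted_wrt_nth_less[OF sorted that] .
  have mono_le: "xs ! i \<le> xs ! j" if "i \<le> j" "j < length xs" for i j
    using mono[of i j] that by (cases "i = j") auto
  have in01: "xs ! i \<in> {0..1}" if "i < length xs" for i
    using nth_mem[OF that] set_xs Z01 by auto
  obtain i0 i1 where i0: "i0 < length xs" "xs ! i0 = 0" and i1: "i1 < length xs" "xs ! i1 = 1"
    using Z01 set_xs by (metis in_set_conv_nth)
  define n where "n = length xs - 1"
  have len: "length xs = Suc n"
    using i0 by (simp add: n_def)
  have t0: "xs ! 0 = 0"
    using mono_le[of 0 i0] i0 in01[of 0] len by auto
  have tn: "xs ! n = 1"
    using mono_le[of i1 n] i1 in01[of n] len by auto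
  have n1: "n \<ge> 1"
    using t0 tn by (cases n) auto
  have step: "xs ! i < xs ! Suc i" if "i < n" for i
    using that len by (intro mono) auto
  have gap: "z \<notin> {xs ! i<..<xs ! Suc i}" if i: "i < n" and z: "z \<in> Z" for i z
  proof -
    obtain j where j: "j < length xs" "z = xs ! j"
      using z set_xs by (metis in_set_conv_nth)
    show ?thesis
    proof (cases "j \<le> i")
      case True
      then show ?thesis
        using mono_le[of j i] i j len by auto
    next
      case False
      then show ?thesis
        using mono_le[of "Suc i" j] i j len by auto
    qed
  qed
  have piece: "\<exists>h\<in>H. \<forall>s\<in>{xs ! i..xs ! Suc i}. f s = h s" if i: "i < n" for i
  proof (rule continuous_selection_eq_on_interval[OF step[OF i] H])
    have sub: "{xs ! i..xs ! Suc i} \<subseteq> {0..1}"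
      using in01[of i] in01[of "Suc i"] i len by auto
    show "continuous_on {xs ! i..xs ! Suc i} f"
      using f sub continuous_on_subset by blast
    show "continuous_on {xs ! i..xs ! Suc i} h" if "h \<in> H" for h
      using cont[OF that] sub continuous_on_subset by blast
    show "\<exists>h\<in>H. f s = h s" if "s \<in> {xs ! i..xs ! Suc i}" for s
      using sel sub that by blast
    show "\<forall>s\<in>{xs ! i<..<xs ! Suc i}. h s = g s"
      if "h \<in> H" "g \<in> H" "s \<in> {xs ! i<..<xs ! Suc i}" "h s = g s" for h g s
    proof -
      have "{xs ! i<..<xs ! Suc i} \<subseteq> {0..1}"
        using sub by (meson greaterThanLessThan_subseteq_atLeastAtMost_iff order_trans order_refl)
      moreover from this have "s \<in> Z" if "finite {s \<in> {0..1}. h s = g s}"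
        using that \<open>h \<in> H\<close> \<open>g \<in> H\<close> \<open>s \<in> _\<close> \<open>h s = g s\<close> unfolding Z_def by blast
      ultimately show ?thesis
        using coincide[OF that(1,2)] gap[OF i] that(3) by blast
    qed
  qed
  have "\<exists>g. P g (xs ! i) (xs ! Suc i) \<and> (\<forall>s\<in>{xs ! i..xs ! Suc i}. f s = g s)" if i: "i < n" for i
    using piece[OF i] P[of _ "xs ! i" "xs ! Suc i"] step[OF i] in01[of i] in01[of "Suc i"] i len
    by (metis atLeastAtMost_iff less_Suc_eq Suc_mono)
  then show ?thesis
    unfolding piecewise_on_unit_def
    using n1 t0 tn step by (intro exI[of _ n] exI[of _ "\<lambda>i. xs ! i"]) auto
qed

text \<open>The closed sets \<open>U h\<close> where \<open>f\<close> agrees with \<open>h\<close>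
  cover the interval, and \<open>f\<close> is \<open>M\<close>-Lipschitz on each. On an interval,
  finitely many such closed sets suffice to make \<open>f\<close> Lipschitz with the same
  constant.\<close>

lemma locally_lipschitz_on_finite_selection:
  assumes H: "finite H" and f: "continuous_on {0..1} f"
    and lip: "\<And>h. h \<in> H \<Longrightarrow> \<exists>L. L-lipschitz_on {0..1} h"
    and sel: "\<And>s. s \<in> {0..1} \<Longrightarrow> \<exists>h\<in>H. f s = h s"
  shows "locally_lipschitz_on {0<..<1} f"
proof -
  obtain L where L: "\<And>h. h \<in> H \<Longrightarrow> (L h)-lipschitz_on {0..1} h"
    using lip by metis
  \<comment> \<open>The extra 0 guarantees a nonempty set and \<open>M \<ge> 0\<close>.\<close>
  define M where "M = Max (insert 0 (L ` H))"
  have M: "M-lipschitz_on {0..1} h" if "h \<in> H" for h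
    using H that by (intro lipschitz_on_le[OF L[OF that]]) (simp add: M_def)
  have M0: "M \<ge> 0"
    using H by (simp add: M_def)
  define U where "U h = {s \<in> {0..1}. f s = h s}" for h
  have "M-lipschitz_on {0..1} f"
  proof (rule lipschitz_on_closed_Union[where U = U and I = H])
    fix h assume h: "h \<in> H"
    have "M-lipschitz_on (U h) h"
      using M[OF h] by (rule lipschitz_on_subset) (auto simp: U_def)
    then show "M-lipschitz_on (U h) f"
      by (rule lipschitz_on_transform) (simp add: U_def)
    have "continuous_on {0..1} (\<lambda>s. f s - h s)"
      using f lipschitz_on_continuous_on[OF M[OF h]] by (rule continuous_on_diff)
    from continuous_closed_preimage_constant[OF this, of 0] show "closed (U h)"
      by (simp add: U_def)
  qed (use H M0 sel in \<open>auto simp: U_def\<close>)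
  then have "\<bar>f s - f u\<bar> \<le> M * \<bar>s - u\<bar>" if "s \<in> {0..1}" "u \<in> {0..1}" for s u
    using that lipschitz_onD by (fastforce simp: dist_real_def)
  then show ?thesis
    unfolding locally_lipschitz_on_def
    \<comment> \<open>The bound is global on \<open>{0..1}\<close>, so any radius serves.\<close>
    by (intro ballI exI[of _ 1] exI[of _ M] conjI) auto
qed

section \<open>Lipschitz bounds, and zeros of real analytic functions\<close>

lemma C1_imp_lipschitz_on_unit:
  fixes f :: "real \<Rightarrow> real"
  assumes der: "\<And>t. t \<in> {0..1} \<Longrightarrow> (f has_real_derivative f' t) (at t)"
    and cont: "continuous_on {0..1} f'"
  shows "\<exists>L. L-lipschitz_on {0..1} f"
proof -
  have "bounded (f' ` {0..1})"
    using cont by (intro compact_imp_bounded compact_continuous_image) auto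
  then obtain B where B: "B > 0" "\<And>t. t \<in> {0..1} \<Longrightarrow> \<bar>f' t\<bar> \<le> B"
    unfolding bounded_pos by auto
  have "B-lipschitz_on {0..1} f"
  proof (rule bounded_derivative_imp_lipschitz)
    show "(f has_derivative (*) (f' t)) (at t within {0..1})" if "t \<in> {0..1}" for t
      using der[OF that] has_field_derivative_def has_derivative_at_withinI by blast
    show "onorm ((*) (f' t)) \<le> B" if "t \<in> {0..1}" for t
      using B(2)[OF that] B(1) by (intro onorm_bound) (auto simp: abs_mult mult_right_mono)
  qed (use B in auto)
  then show ?thesis ..
qed

text \<open>Termwise differentiation of the local series. Continuity of the derivative is claimed at
  the centre only, which is enough because every point of \<open>S\<close> is a centre.\<close>

lemma real_analytic_on_C1:
  assumes "real_analytic_on f S" "t \<in> S"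
  shows "\<exists>r>0. \<exists>f'. (\<forall>s\<in>ball t r. (f has_real_derivative f' s) (at s)) \<and> isCont f' t"
proof -
  obtain r a where r: "r > 0" and a: "\<And>s. \<bar>s - t\<bar> < r \<Longrightarrow> (\<lambda>n. a n * (s - t) ^ n) sums f s"
    using assms unfolding real_analytic_on_def by blast
  have summ: "summable (\<lambda>n. a n * x ^ n)" if "norm x < r" for x
    using a[of "t + x"] that by (auto simp: sums_iff)
  have summ': "summable (\<lambda>n. diffs a n * x ^ n)" if "norm x < r" for x
    using termdiff_converges[OF that summ] .
  define F where "F x = (\<Sum>n. a n * x ^ n)" for x
  define G where "G x = (\<Sum>n. diffs a n * x ^ n)" for x
  have F: "(F has_real_derivative G x) (at x)" if "norm x < r" for x
    unfolding F_def G_def by (rule termdiffs_strong'[OF summ that])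
  \<comment> \<open>The differentiated series converges on the same disc, so a second termwise
    differentiation shows that \<open>G\<close> is differentiable at 0.\<close>
  have "isCont G 0"
    unfolding G_def using r by (intro DERIV_isCont[OF termdiffs_strong'[OF summ']]) auto
  then have "isCont (\<lambda>s. G (s - t)) t"
    using isCont_o2[of t "\<lambda>s. s - t" G] by (simp add: continuous_intros)
  moreover have "(f has_real_derivative G (s - t)) (at s)" if "s \<in> ball t r" for s
  proof (rule has_field_derivative_transform_within_open)
    have s: "norm (s - t) < r"
      using that by (simp add: dist_real_def)
    show "((\<lambda>s. F (s - t)) has_real_derivative G (s - t)) (at s)"
      using DERIV_shift[of F "G (s - t)" s "- t"] F[OF s] by simp
    show "F (x - t) = f x" if "x \<in> ball t r" for x
      using a[of x] that by (simp add: F_def sums_iff dist_real_def abs_minus_commute)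
  qed (use that in auto)
  ultimately show ?thesis
    using r by (intro exI[of _ r] exI[of _ "\<lambda>s. G (s - t)"] conjI ballI)
qed

text \<open>The local derivatives \<open>f'\<close> depend on the chosen centre;
  \<open>deriv f\<close> is the single function that agrees with each of them nearby and inherits
  their continuity.\<close>

lemma real_analytic_on_imp_lipschitz_on_unit:
  assumes f: "real_analytic_on f S" and S: "{0..1} \<subseteq> S"
  shows "\<exists>L. L-lipschitz_on {0..1} f"
proof (rule C1_imp_lipschitz_on_unit)
  fix t :: real assume "t \<in> {0..1}"
  then show "(f has_real_derivative deriv f t) (at t)"
    using real_analytic_on_C1[OF f, of t] S DERIV_imp_deriv by (metis centre_in_ball subsetD)
next
  show "continuous_on {0..1} (deriv f)"
  proof (rule continuous_at_imp_continuous_on, intro ballI)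
    fix t :: real assume "t \<in> {0..1}"
    then obtain r f' where r: "r > 0" and f': "\<And>s. s \<in> ball t r \<Longrightarrow> (f has_real_derivative f' s) (at s)"
      and c: "isCont f' t"
      using real_analytic_on_C1[OF f, of t] S by blast
    have "eventually (\<lambda>s. s \<in> ball t r) (nhds t)"
      using r by (intro eventually_nhds_in_open) auto
    then have "eventually (\<lambda>s. deriv f s = f' s) (nhds t)"
      by eventually_elim (rule DERIV_imp_deriv[OF f'])
    then show "isCont (deriv f) t"
      using c by (simp add: isCont_cong)
  qed
qed

lemma real_analytic_on_zero_isolated:
  assumes f: "real_analytic_on f S" and t: "t \<in> S"
  shows "\<exists>r>0. (\<forall>s\<in>ball t r. f s = 0) \<or> (\<forall>s\<in>ball t r - {t}. f s \<noteq> 0)"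
proof -
  obtain r a where r: "r > 0" and a: "\<And>s. \<bar>s - t\<bar> < r \<Longrightarrow> (\<lambda>n. a n * (s - t) ^ n) sums f s"
    using assms unfolding real_analytic_on_def by blast
  show ?thesis
  proof (cases "f t = 0")
    case False
    have "isCont f t"
      using real_analytic_on_C1[OF f t] DERIV_isCont by (metis centre_in_ball)
    then obtain e where "e > 0" "\<And>s. dist t s < e \<Longrightarrow> f s \<noteq> 0"
      using continuous_at_avoid[of t f 0] False by blast
    then show ?thesis
      by (intro exI[of _ e]) auto
  next
    case True
    show ?thesis
    proof (cases "\<exists>m>0. a m \<noteq> 0")
      case True
      then obtain m where m: "m > 0" "a m \<noteq> 0"
        by blast
      obtain s where "s > 0" "\<And>z. z \<in> cball t s - {t} \<Longrightarrow> f z \<noteq> 0"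
        using powser_0_nonzero[of r t a f m] r a m \<open>f t = 0\<close> by (auto simp: real_norm_def)
      then show ?thesis
        by (intro exI[of _ s]) auto
    next
      case False
      have "f s = 0" if "s \<in> ball t r" for s
      proof -
        have a0: "a 0 = 0"
          using a[of t] r True powser_sums_zero[of a] sums_unique2 by fastforce
        then have "a n = 0" for n
          using False by (cases n) auto
        then show ?thesis
          using a[of s] that sums_unique2[OF sums_zero] by (force simp: dist_real_def)
      qed
      then show ?thesis
        using r by blast
    qed
  qed
qed

text \<open>The identity theorem on a compact interval. \<open>A\<close> and \<open>B\<close> are
  disjoint open sets covering \<open>{0..1}\<close>, so one of them misses it. If \<open>A\<close>
  does, no point of the interval is a limit of zeros, and compactness bounds their number. At 0 and
  1 the expansions are two-sided as well.\<close>

lemma real_analytic_on_finite_zeros_or_zero: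
  assumes f: "real_analytic_on f S" and S: "{0..1} \<subseteq> S"
  shows "finite {t \<in> {0..1}. f t = 0} \<or> (\<forall>t\<in>{0..1}. f t = 0)"
proof -
  define A where "A = {t. \<exists>r>0. \<forall>s\<in>ball t r. f s = 0}"
  \<comment> \<open>The value at \<open>t\<close> itself is left free, so \<open>B\<close> holds
    both the isolated zeros and the points where a continuous \<open>f\<close> does not
    vanish.\<close>
  define B where "B = {t. \<exists>r>0. \<forall>s\<in>ball t r - {t}. f s \<noteq> 0}"
  have cover: "{0..1} \<subseteq> A \<union> B"
    using real_analytic_on_zero_isolated[OF f] S unfolding A_def B_def by blast
  have "open A"
    unfolding open_contains_ball
  proof
    fix t assume "t \<in> A"
    then obtain r where r: "r > 0" "\<forall>s\<in>ball t r. f s = 0"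
      by (auto simp: A_def)
    have "u \<in> A" if u: "u \<in> ball t r" for u
    proof -
      obtain e where "e > 0" "ball u e \<subseteq> ball t r"
        using u open_ball[of t r] unfolding open_contains_ball by blast
      then show ?thesis
        using r unfolding A_def by blast
    qed
    then show "\<exists>e>0. ball t e \<subseteq> A"
      using r by blast
  qed
  moreover have "open B"
    unfolding open_contains_ball
  proof
    fix t assume "t \<in> B"
    then obtain r where r: "r > 0" "\<forall>s\<in>ball t r - {t}. f s \<noteq> 0"
      by (auto simp: B_def)
    have "u \<in> B" if u: "u \<in> ball t r" for u
    proof (cases "u = t")
      case True
      then show ?thesis
        using \<open>t \<in> B\<close> by simp
    next
      case False
      then have "open (ball t r - {t})" "u \<in> ball t r - {t}"
        using u by auto
      then obtain e where "e > 0" "ball u e \<subseteq> ball t r - {t}"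
        unfolding open_contains_ball by blast
      then show ?thesis
        using r unfolding B_def by blast
    qed
    then show "\<exists>e>0. ball t e \<subseteq> B"
      using r by blast
  qed
  moreover have "A \<inter> B = {}"
  proof (rule ccontr)
    assume "A \<inter> B \<noteq> {}"
    then obtain t r e where *: "r > 0" "\<forall>s\<in>ball t r. f s = 0" "e > 0" "\<forall>s\<in>ball t e - {t}. f s \<noteq> 0"
      by (auto simp: A_def B_def)
    define u where "u = t + min r e / 2"
    have "u \<in> ball t r" "u \<in> ball t e - {t}"
      using * by (auto simp: u_def dist_real_def)
    then show False
      using * by blast
  qed
  ultimately have "A \<inter> {0..1} = {} \<or> B \<inter> {0..1} = {}"
    using cover connectedD[of "{0..1::real}" A B] connected_Icc by blast
  then show ?thesis
  proof
    assume "B \<inter> {0..1} = {}"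
    then have "{0..1} \<subseteq> A"
      using cover by blast
    then have "f t = 0" if "t \<in> {0..1}" for t
      using that by (force simp: A_def)
    then show ?thesis
      by blast
  next
    assume A0: "A \<inter> {0..1} = {}"
    have "finite ({0..1} \<inter> {t. f t = 0})"
    proof (rule finite_not_islimpt_in_compact)
      fix t :: real assume "t \<in> {0..1}"
      then obtain r where "r > 0" "\<forall>s\<in>ball t r - {t}. f s \<noteq> 0"
        using A0 cover unfolding B_def by blast
      then show "\<not> t islimpt {t. f t = 0}"
        unfolding islimpt_approachable by (auto simp: dist_commute)
    qed auto
    then show ?thesis
      by (simp add: Int_def)
  qed
qed

lemma real_analytic_on_add:
  assumes "real_analytic_on f U" "real_analytic_on g V"
  shows "real_analytic_on (\<lambda>t. f t + g t) (U \<inter> V)"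
  unfolding real_analytic_on_def
proof
  fix t assume t: "t \<in> U \<inter> V"
  obtain r a where r: "r > 0" "\<And>s. \<bar>s - t\<bar> < r \<Longrightarrow> (\<lambda>n. a n * (s - t) ^ n) sums f s"
    using t assms(1) unfolding real_analytic_on_def by blast
  obtain e b where e: "e > 0" "\<And>s. \<bar>s - t\<bar> < e \<Longrightarrow> (\<lambda>n. b n * (s - t) ^ n) sums g s"
    using t assms(2) unfolding real_analytic_on_def by blast
  have "(\<lambda>n. (a n + b n) * (s - t) ^ n) sums (f s + g s)" if "\<bar>s - t\<bar> < min r e" for s
    using sums_add[OF r(2) e(2), of s s] that by (simp add: distrib_right)
  then show "\<exists>r>0. \<exists>a. \<forall>s. \<bar>s - t\<bar> < r \<longrightarrow> (\<lambda>n. a n * (s - t) ^ n) sums (f s + g s)"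
    using r(1) e(1)
    by (intro exI[of _ "min r e"] conjI exI[of _ "\<lambda>n. a n + b n"] allI impI) simp_all
qed

lemma real_analytic_on_cmult:
  assumes "real_analytic_on f U"
  shows "real_analytic_on (\<lambda>t. c * f t) U"
  unfolding real_analytic_on_def
proof
  fix t assume t: "t \<in> U"
  obtain r a where r: "r > 0" "\<And>s. \<bar>s - t\<bar> < r \<Longrightarrow> (\<lambda>n. a n * (s - t) ^ n) sums f s"
    using t assms unfolding real_analytic_on_def by blast
  have "(\<lambda>n. (c * a n) * (s - t) ^ n) sums (c * f s)" if "\<bar>s - t\<bar> < r" for s
    using sums_mult[OF r(2)[OF that], of c] by (simp add: mult.assoc)
  then show "\<exists>r>0. \<exists>a. \<forall>s. \<bar>s - t\<bar> < r \<longrightarrow> (\<lambda>n. a n * (s - t) ^ n) sums (c * f s)"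
    using r(1) by (intro exI[of _ r] conjI exI[of _ "\<lambda>n. c * a n"] allI impI)
qed

lemma real_analytic_on_const: "real_analytic_on (\<lambda>_. c) U"
  unfolding real_analytic_on_def
proof
  fix t
  have "(\<lambda>n. (if n = 0 then c else 0) * (s - t) ^ n) sums c" for s
    using sums_mult[OF powser_sums_if[of 0 "s - t"], of c]
    by (simp add: if_distrib[of "(*) c"] flip: mult.assoc cong: if_cong)
  then show "\<exists>r>0. \<exists>a. \<forall>s. \<bar>s - t\<bar> < r \<longrightarrow> (\<lambda>n. a n * (s - t) ^ n) sums c"
    by (intro exI[of _ 1] conjI exI[of _ "\<lambda>n. if n = 0 then c else 0"] allI impI) simp_all
qed

section \<open>Curvature along a local random walk\<close>

text \<open>What the argument asks of a kind of piece: a linear space of functions with constants,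
  to accommodate the functionals of the marginals; Lipschitz bounds, for regularity; and finitely
  many zeros or none but the trivial case, for the breakpoints.\<close>

locale piece_class =
  fixes P :: "(real \<Rightarrow> real) \<Rightarrow> real \<Rightarrow> real \<Rightarrow> bool"
  assumes const: "P (\<lambda>_. c) 0 1"
    and add: "P f 0 1 \<Longrightarrow> P g 0 1 \<Longrightarrow> P (\<lambda>t. f t + g t) 0 1"
    and cmult: "P f 0 1 \<Longrightarrow> P (\<lambda>t. c * f t) 0 1"
    and restrict: "P f 0 1 \<Longrightarrow> 0 \<le> a \<Longrightarrow> b \<le> 1 \<Longrightarrow> P f a b"
    and lipschitz: "P f 0 1 \<Longrightarrow> \<exists>L. L-lipschitz_on {0..1} f"
    and zeros: "P f 0 1 \<Longrightarrow> finite {t \<in> {0..1}. f t = 0} \<or> (\<forall>t\<in>{0..1}. f t = 0)"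
begin

lemma sum: "(\<And>i. i \<in> I \<Longrightarrow> P (f i) 0 1) \<Longrightarrow> P (\<lambda>t. \<Sum>i\<in>I. f i t) 0 1"
  by (induction I rule: infinite_finite_induct) (auto intro: const add)

lemma coincidence:
  assumes "P f 0 1" "P g 0 1"
  shows "finite {t \<in> {0..1}. f t = g t} \<or> (\<forall>t\<in>{0..1}. f t = g t)"
  using zeros[OF add[OF assms(1) cmult[OF assms(2), of "-1"]]] by simp

lemma ORic_locally_lipschitz_piecewise:
  assumes d: "complete_distance d" and rw: "random_walk d mu" and loc: "local_walk mu"
    and walk: "\<And>x z. \<exists>g. P g 0 1 \<and> (\<forall>t\<in>{0..1}. g t = pmf (mu x t) z)"
  shows "locally_lipschitz_on {0<..<1} (\<lambda>t. ORic d mu t x y) \<and>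
    piecewise_on_unit P (\<lambda>t. ORic d mu t x y)"
proof -
  have metric: "Metric_space UNIV d"
    using d by (simp add: complete_distance_def)
  obtain Kx Ky where Kxy: "finite Kx" "finite Ky" "\<And>t. t \<in> {0..1} \<Longrightarrow> set_pmf (mu x t) \<subseteq> Kx"
    "\<And>t. t \<in> {0..1} \<Longrightarrow> set_pmf (mu y t) \<subseteq> Ky"
    using loc unfolding local_walk_def by metis
  define K where "K = Kx \<union> Ky"
  have K: "finite K" and sup: "\<And>t. t \<in> {0..1} \<Longrightarrow> set_pmf (mu x t) \<subseteq> K"
      "\<And>t. t \<in> {0..1} \<Longrightarrow> set_pmf (mu y t) \<subseteq> K"
    using Kxy unfolding K_def by blast+
  \<comment> \<open>The candidates \<open>h\<close> are built from the extensions \<open>G\<close>,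
    since \<open>P\<close> may restrict a function beyond \<open>{0..1}\<close>, where the walk
    itself is not controlled.\<close>
  obtain G where G: "\<And>x z. P (G x z) 0 1" "\<And>x z t. t \<in> {0..1} \<Longrightarrow> G x z t = pmf (mu x t) z"
    using walk by metis
  obtain F where F: "finite F" "\<And>\<mu> \<nu>. set_pmf \<mu> \<subseteq> K \<Longrightarrow> set_pmf \<nu> \<subseteq> K \<Longrightarrow>
      \<exists>(u, v)\<in>F. W1 d \<mu> \<nu> = (\<Sum>a\<in>K. u a * pmf \<mu> a + v a * pmf \<nu> a)"
    using W1_finitely_many_functionals[OF K, of d] by blast
  define h where "h w t = 1 + (- 1 / d x y) * (\<Sum>a\<in>K. fst w a * G x a t + snd w a * G y a t)" for w t
  define H where "H = h ` F"
  have H: "finite H"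
    using F by (simp add: H_def)
  have PH: "P g 0 1" if gH: "g \<in> H" for g
  proof -
    obtain w where "g = h w"
      using gH by (auto simp: H_def)
    then show ?thesis
      unfolding h_def by (simp only:) (intro const add cmult sum G)
  qed
  have sel: "\<exists>g\<in>H. ORic d mu t x y = g t" if t: "t \<in> {0..1}" for t
  proof -
    obtain u v where uv: "(u, v) \<in> F"
        "W1 d (mu x t) (mu y t) = (\<Sum>a\<in>K. u a * pmf (mu x t) a + v a * pmf (mu y t) a)"
      using F(2)[OF sup[OF t]] by blast
    have "ORic d mu t x y = h (u, v) t"
      using uv t by (simp add: ORic_def h_def G)
    then show ?thesis
      using uv by (auto simp: H_def)
  qed
  have cont: "continuous_on {0..1} (\<lambda>t. ORic d mu t x y)"
    unfolding ORic_def divide_inverse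
    using continuous_on_W1_walk[OF metric rw K sup] by (intro continuous_intros)
  show ?thesis
  proof
    show "locally_lipschitz_on {0<..<1} (\<lambda>t. ORic d mu t x y)"
      using locally_lipschitz_on_finite_selection[OF H cont lipschitz[OF PH] sel] .
    show "piecewise_on_unit P (\<lambda>t. ORic d mu t x y)"
    proof (rule piecewise_on_unit_finite_selection[OF H cont _ sel])
      show "continuous_on {0..1} g" if "g \<in> H" for g
        using lipschitz[OF PH[OF that]] lipschitz_on_continuous_on by blast
    qed (use coincidence[OF PH PH] restrict[OF PH] in simp_all)
  qed
qed

end

section \<open>The three classes of pieces\<close>

lemma piece_class_analytic: "piece_class analytic_piece"
proof
  show "analytic_piece (\<lambda>_. c) 0 1" for c
    unfolding analytic_piece_def using real_analytic_on_const open_UNIV by blast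
  show "analytic_piece (\<lambda>t. f t + g t) 0 1" if "analytic_piece f 0 1" "analytic_piece g 0 1" for f g
  proof -
    obtain U V where "open U" "{0..1} \<subseteq> U" "real_analytic_on f U"
        "open V" "{0..1} \<subseteq> V" "real_analytic_on g V"
      using \<open>analytic_piece f 0 1\<close> \<open>analytic_piece g 0 1\<close> unfolding analytic_piece_def by blast
    then show ?thesis
      unfolding analytic_piece_def
      by (intro exI[of _ "U \<inter> V"] conjI open_Int real_analytic_on_add) auto
  qed
  show "analytic_piece (\<lambda>t. c * f t) 0 1" if "analytic_piece f 0 1" for c f
    using that unfolding analytic_piece_def by (blast intro: real_analytic_on_cmult)
  show "analytic_piece f a b" if "analytic_piece f 0 1" "0 \<le> a" "b \<le> 1" for f a b
  proof -
    have "{a..b} \<subseteq> {0..1}"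
      using that by auto
    then show ?thesis
      using that(1) unfolding analytic_piece_def by blast
  qed
  show "\<exists>L. L-lipschitz_on {0..1} f" if "analytic_piece f 0 1" for f
    using that unfolding analytic_piece_def by (blast intro: real_analytic_on_imp_lipschitz_on_unit)
  show "finite {t \<in> {0..1}. f t = 0} \<or> (\<forall>t\<in>{0..1}. f t = 0)" if "analytic_piece f 0 1" for f
    using that real_analytic_on_finite_zeros_or_zero unfolding analytic_piece_def by blast
qed

lemma polynomial_piece_iff: "polynomial_piece f a b \<longleftrightarrow> (\<exists>q. f = poly q)"
  by (auto simp: polynomial_piece_def)

lemma affine_imp_polynomial_piece:
  assumes "affine_piece f a b"
  shows "polynomial_piece f a b"
proof -
  obtain \<alpha> \<beta> where "f = poly [:\<alpha>, \<beta>:]"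
    using assms by (auto simp: affine_piece_def fun_eq_iff algebra_simps)
  then show ?thesis
    by (auto simp: polynomial_piece_iff)
qed

lemma poly_lipschitz_on_unit:
  fixes q :: "real poly"
  shows "\<exists>L. L-lipschitz_on {0..1} (poly q)"
  by (rule C1_imp_lipschitz_on_unit[where f' = "poly (pderiv q)"])
    (auto intro: poly_DERIV continuous_intros)

lemma poly_finite_zeros_or_zero:
  fixes q :: "real poly"
  shows "finite {t \<in> {0..1}. poly q t = 0} \<or> (\<forall>t\<in>{0..1}. poly q t = 0)"
proof (cases "q = 0")
  case False
  have "{t \<in> {0..1}. poly q t = 0} \<subseteq> {t. poly q t = 0}"
    by auto
  then show ?thesis
    using poly_roots_finite[OF False] finite_subset by blast
qed simp

lemma piece_class_polynomial: "piece_class polynomial_piece"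
proof
  show "polynomial_piece (\<lambda>_. c) 0 1" for c
    unfolding polynomial_piece_def by (intro exI[of _ "[:c:]"]) simp
  show "polynomial_piece (\<lambda>t. f t + g t) 0 1" if "polynomial_piece f 0 1" "polynomial_piece g 0 1" for f g
    using that unfolding polynomial_piece_def by (metis poly_add)
  show "polynomial_piece (\<lambda>t. c * f t) 0 1" if "polynomial_piece f 0 1" for c f
    using that unfolding polynomial_piece_def by (metis poly_smult)
  show "\<exists>L. L-lipschitz_on {0..1} f" if "polynomial_piece f 0 1" for f
    using that poly_lipschitz_on_unit by (auto simp: polynomial_piece_iff)
  show "finite {t \<in> {0..1}. f t = 0} \<or> (\<forall>t\<in>{0..1}. f t = 0)" if "polynomial_piece f 0 1" for f
    using that poly_finite_zeros_or_zero unfolding polynomial_piece_iff by blast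
qed (simp add: polynomial_piece_def)

text \<open>Linear closure is checked directly, because the pieces must stay affine; Lipschitz
  bounds and zeros are inherited from polynomials.\<close>

lemma piece_class_affine: "piece_class affine_piece"
proof -
  interpret poly: piece_class polynomial_piece
    by (rule piece_class_polynomial)
  show ?thesis
  proof
    show "affine_piece (\<lambda>_. c) 0 1" for c
      unfolding affine_piece_def by (intro exI[of _ c] exI[of _ 0]) simp
    show "affine_piece (\<lambda>t. f t + g t) 0 1" if fg: "affine_piece f 0 1" "affine_piece g 0 1" for f g
    proof -
      obtain \<alpha> \<beta> \<gamma> \<delta> where "\<And>t. f t = \<alpha> + \<beta> * t" "\<And>t. g t = \<gamma> + \<delta> * t"
        using fg unfolding affine_piece_def by blast
      then show ?thesis
        unfolding affine_piece_def
        by (intro exI[of _ "\<alpha> + \<gamma>"] exI[of _ "\<beta> + \<delta>"]) (simp add: algebra_simps)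
    qed
    show "affine_piece (\<lambda>t. c * f t) 0 1" if f: "affine_piece f 0 1" for c f
    proof -
      obtain \<alpha> \<beta> where "\<And>t. f t = \<alpha> + \<beta> * t"
        using f unfolding affine_piece_def by blast
      then show ?thesis
        unfolding affine_piece_def
        by (intro exI[of _ "c * \<alpha>"] exI[of _ "c * \<beta>"]) (simp add: algebra_simps)
    qed
    show "\<exists>L. L-lipschitz_on {0..1} f" if "affine_piece f 0 1" for f
      by (rule poly.lipschitz[OF affine_imp_polynomial_piece[OF that]])
    show "finite {t \<in> {0..1}. f t = 0} \<or> (\<forall>t\<in>{0..1}. f t = 0)" if "affine_piece f 0 1" for f
      by (rule poly.zeros[OF affine_imp_polynomial_piece[OF that]])
  qed (simp add: affine_piece_def)
qed

theorem mainTheorem5: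
  fixes E :: "'v \<Rightarrow> 'v \<Rightarrow> bool" and d :: "'v \<Rightarrow> 'v \<Rightarrow> real"
    and mu :: "'v \<Rightarrow> real \<Rightarrow> 'v pmf"
  assumes "locally_finite_graph E" and "complete_distance d"
    and "random_walk d mu" and "local_walk mu"
  shows "(time_analytic mu \<longrightarrow> (\<forall>x y. x \<noteq> y \<longrightarrow>
            locally_lipschitz_on {0<..<1} (\<lambda>\<epsilon>. ORic d mu \<epsilon> x y) \<and>
            piecewise_on_unit analytic_piece (\<lambda>\<epsilon>. ORic d mu \<epsilon> x y))) \<and>
         (time_affine mu \<longrightarrow> (\<forall>x y. x \<noteq> y \<longrightarrow>
            locally_lipschitz_on {0<..<1} (\<lambda>\<epsilon>. ORic d mu \<epsilon> x y) \<and>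
            piecewise_on_unit affine_piece (\<lambda>\<epsilon>. ORic d mu \<epsilon> x y))) \<and>
         (time_polynomial mu \<longrightarrow> (\<forall>x y. x \<noteq> y \<longrightarrow>
            locally_lipschitz_on {0<..<1} (\<lambda>\<epsilon>. ORic d mu \<epsilon> x y) \<and>
            piecewise_on_unit polynomial_piece (\<lambda>\<epsilon>. ORic d mu \<epsilon> x y)))"
proof (intro conjI[of "_ \<longrightarrow> _"] impI allI)
  fix x y
  assume an: "time_analytic mu"
  have "\<exists>g. analytic_piece g 0 1 \<and> (\<forall>t\<in>{0..1}. g t = pmf (mu x t) z)" for x z
  proof -
    obtain \<delta> g where "\<delta> > 0" "real_analytic_on g {-\<delta><..<1+\<delta>}" "\<forall>t\<in>{0..1}. g t = pmf (mu x t) z"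
      using an unfolding time_analytic_def by blast
    \<comment> \<open>The continuation interval is the open neighbourhood that
      \<open>analytic_piece\<close> demands.\<close>
    moreover from this have "{0..1} \<subseteq> {-\<delta><..<1+\<delta>}"
      by auto
    ultimately show ?thesis
      unfolding analytic_piece_def using open_greaterThanLessThan by blast
  qed
  then show "locally_lipschitz_on {0<..<1} (\<lambda>\<epsilon>. ORic d mu \<epsilon> x y) \<and>
      piecewise_on_unit analytic_piece (\<lambda>\<epsilon>. ORic d mu \<epsilon> x y)"
    by (rule piece_class.ORic_locally_lipschitz_piecewise[OF piece_class_analytic assms(2-4)])
next
  fix x y
  assume aff: "time_affine mu"
  have "\<exists>g. affine_piece g 0 1 \<and> (\<forall>t\<in>{0..1}. g t = pmf (mu x t) z)" for x z
  proof -
    obtain \<alpha> \<beta> where "\<forall>t\<in>{0..1}. pmf (mu x t) z = \<alpha> + \<beta> * t"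
      using aff unfolding time_affine_def by blast
    then show ?thesis
      unfolding affine_piece_def by (intro exI[of _ "\<lambda>t. \<alpha> + \<beta> * t"]) auto
  qed
  then show "locally_lipschitz_on {0<..<1} (\<lambda>\<epsilon>. ORic d mu \<epsilon> x y) \<and>
      piecewise_on_unit affine_piece (\<lambda>\<epsilon>. ORic d mu \<epsilon> x y)"
    by (rule piece_class.ORic_locally_lipschitz_piecewise[OF piece_class_affine assms(2-4)])
next
  fix x y
  assume pol: "time_polynomial mu"
  have "\<exists>g. polynomial_piece g 0 1 \<and> (\<forall>t\<in>{0..1}. g t = pmf (mu x t) z)" for x z
    using pol unfolding time_polynomial_def polynomial_piece_iff by metis
  then show "locally_lipschitz_on {0<..<1} (\<lambda>\<epsilon>. ORic d mu \<epsilon> x y) \<and>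
      piecewise_on_unit polynomial_piece (\<lambda>\<epsilon>. ORic d mu \<epsilon> x y)"
    by (rule piece_class.ORic_locally_lipschitz_piecewise[OF piece_class_polynomial assms(2-4)])
qed

end
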